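(* Consider the magnetization $M_n$ of the cubic mean-field Ising model with parameters $(\beta,h)\in(0,\infty)\times\mathbb R$, with $A$ and $\gamma$ as in the context. All limits are as $n\to\infty$. (i) If $(\beta,h)\in((0,\infty)\times\mathbb R)\setminus\gamma$, with unique maximizer $a_*$ of $A$, then $M_n/n\to2a_*-1$ in law; for every sufficiently small $\delta>0$ there is $c>0$ such that $\mu_n(|M_n/n-(2a_*-1)|>\delta)\le e^{-cn}$ for all large $n$; and $$d_{\mathrm W}\Big(\frac{M_n-n(2a_*-1)}{\sqrt n},\,N\Big(0,\frac{4}{|A''(a_* )|}\Big)\Big)=O(n^{-1/2}).$$ (ii) If $(\beta,h)\in\gamma$, with maximizers $a_-=1/2<a_+$ of $A$, then: for every sufficiently small $\delta>0$ there is $c>0$ such that $\mu_n(|M_n/n-(2a_i-1)|>\delta\text{ for both }i\in\{-,+\})\le e^{-cn}$ for all large $n$; $M_n/n$ converges in law to $p_-\delta_{2a_--1}+p_+\delta_{2a_+-1}$, where $p_i=q_ie^{\nu_i}/(q_-e^{\nu_-}+q_+e^{\nu_+})$, $q_i=\int_{\mathbb R}\exp(\frac12A''(a_i)x^2)\,dx$, $e^{\nu_i}=(a_i(1-a_i))^{-1/2}$; and for $i\in\{-,+\}$ and every sufficiently small $\delta>0$, $$d_{\mathrm W}\Big(\mathcal L\Big(\frac{M_n-n(2a_i-1)}{\sqrt n}\,\Big|\,|M_n/n-(2a_i-1)|\le\delta\Big),\,N\Big(0,\frac{4}{|A''(a_i)|}\Big)\Big)=O(n^{-1/2}).$$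
   Context: For $\omega\in\{1,-1\}^n$ let $\bar\omega_+=|\{i:\omega_i=1\}|/n$ and $M_n=\omega_1+\dots+\omega_n$. The cubic mean-field model is $\mu_n(\omega)\propto\exp(nf_{\beta,h}(\bar\omega_+))$ on $\{1,-1\}^n$, with $f_{\beta,h}(a)=\beta(2a-1)^3+h(2a-1)^2$. Let $I(a)=-a\log a-(1-a)\log(1-a)$ on $[0,1]$ ($0\log0=0$) and $A=f_{\beta,h}+I$. A maximizer $a$ of $A$ is 2-regular if $A'(a)=0$ and $A''(a)<0$. It is known (part of the setting) that there is a function $g:(0,\infty)\to\mathbb R$ such that, with $\gamma=\{(\beta,h):h=g(\beta),\beta>0\}$: if $(\beta,h)\in((0,\infty)\times\mathbb R)\setminus\gamma$, then $A$ has a unique maximizer $a_*\in(0,1)$ and it is 2-regular; if $(\beta,h)\in\gamma$, then $A$ has exactly two maximizers $1/2=a_-<a_+<1$, both 2-regular. $d_{\mathrm W}(X,Y)=\sup_{\|h'\|_\infty\le1}|\mathbb Eh(X)-\mathbb Eh(Y)|$; $N(0,\sigma^2)$ is the centered normal law with variance $\sigma^2$. Constants in $O(\cdot)$ do not depend on $n$. *)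

theory Defs
  imports "HOL-Probability.Probability"
begin

section \<open>The cubic mean-field Ising model\<close>

definition configs :: "nat \<Rightarrow> (nat \<Rightarrow> real) set" where
  "configs n = PiE {..<n} (\<lambda>_. {1, -1})"

definition plus_fraction :: "nat \<Rightarrow> (nat \<Rightarrow> real) \<Rightarrow> real" where
  "plus_fraction n \<omega> = real (card {i \<in> {..<n}. \<omega> i = 1}) / real n"

definition magnetization :: "nat \<Rightarrow> (nat \<Rightarrow> real) \<Rightarrow> real" where
  "magnetization n \<omega> = (\<Sum>i<n. \<omega> i)"

definition f_cubic :: "real \<Rightarrow> real \<Rightarrow> real \<Rightarrow> real" where
  "f_cubic \<beta> h a = \<beta> * (2 * a - 1) ^ 3 + h * (2 * a - 1) ^ 2"

definition partition_fun :: "real \<Rightarrow> real \<Rightarrow> nat \<Rightarrow> real" where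
  "partition_fun \<beta> h n = (\<Sum>\<omega>\<in>configs n. exp (real n * f_cubic \<beta> h (plus_fraction n \<omega>)))"

definition gibbs :: "real \<Rightarrow> real \<Rightarrow> nat \<Rightarrow> (nat \<Rightarrow> real) measure" where
  "gibbs \<beta> h n = point_measure (configs n)
     (\<lambda>\<omega>. ennreal (exp (real n * f_cubic \<beta> h (plus_fraction n \<omega>)) / partition_fun \<beta> h n))"


section \<open>The variational problem\<close>

text \<open>The convention \<open>0 log 0 = 0\<close> holds because \<open>0 * x = 0\<close>, whatever the value of \<open>ln 0\<close>.\<close>

definition entropy_fun :: "real \<Rightarrow> real" where
  "entropy_fun a = - a * ln a - (1 - a) * ln (1 - a)"

definition A_fun :: "real \<Rightarrow> real \<Rightarrow> real \<Rightarrow> real" where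
  "A_fun \<beta> h a = f_cubic \<beta> h a + entropy_fun a"

definition A_second :: "real \<Rightarrow> real \<Rightarrow> real \<Rightarrow> real" where
  "A_second \<beta> h a = deriv (deriv (A_fun \<beta> h)) a"

definition maximizers :: "real \<Rightarrow> real \<Rightarrow> real set" where
  "maximizers \<beta> h = {a \<in> {0..1}. \<forall>b\<in>{0..1}. A_fun \<beta> h b \<le> A_fun \<beta> h a}"

definition two_regular :: "real \<Rightarrow> real \<Rightarrow> real \<Rightarrow> bool" where
  "two_regular \<beta> h a \<longleftrightarrow>
     a \<in> maximizers \<beta> h \<and> (A_fun \<beta> h has_real_derivative 0) (at a) \<and> A_second \<beta> h a < 0"

definition gamma_curve :: "(real \<Rightarrow> real) \<Rightarrow> (real \<times> real) set" where
  "gamma_curve g = {(\<beta>, h). h = g \<beta> \<and> \<beta> > 0}"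

text \<open>The defining property of the phase-transition curve. It determines \<open>g\<close> on \<open>{0<..}\<close>, the
  only place where \<open>g\<close> is evaluated, since it characterizes the \<open>(\<beta>, h)\<close> with several maximizers.\<close>

definition transition_function :: "(real \<Rightarrow> real) \<Rightarrow> bool" where
  "transition_function g \<longleftrightarrow>
     (\<forall>\<beta> h. (\<beta>, h) \<in> ({0<..} \<times> UNIV) - gamma_curve g \<longrightarrow>
        (\<exists>a. 0 < a \<and> a < 1 \<and> maximizers \<beta> h = {a} \<and> two_regular \<beta> h a)) \<and>
     (\<forall>\<beta> h. (\<beta>, h) \<in> gamma_curve g \<longrightarrow>
        (\<exists>a. 1/2 < a \<and> a < 1 \<and> maximizers \<beta> h = {1/2, a} \<and>
             two_regular \<beta> h (1/2) \<and> two_regular \<beta> h a))"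


section \<open>Probability distances and limit laws\<close>

text \<open>For (locally) absolutely continuous \<open>h\<close>, the condition that the essential supremum of
  \<open>\<bar>h'\<bar>\<close> be at most 1 says exactly that \<open>h\<close> is 1-Lipschitz. The supremum is taken in \<open>ennreal\<close> so
  that an unbounded family gives \<open>\<infinity>\<close>.\<close>

definition wasserstein :: "real measure \<Rightarrow> real measure \<Rightarrow> ennreal" where
  "wasserstein P Q =
     (SUP h\<in>{h::real \<Rightarrow> real. 1-lipschitz_on UNIV h}. ennreal \<bar>(\<integral>x. h x \<partial>P) - (\<integral>x. h x \<partial>Q)\<bar>)"

text \<open>\<open>normal_density\<close> takes the standard deviation as its parameter, \<open>centered_normal\<close> the variance.\<close>

definition centered_normal :: "real \<Rightarrow> real measure" where
  "centered_normal v = density lborel (\<lambda>x. ennreal (normal_density 0 (sqrt v) x))"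

text \<open>The mixture \<open>p \<delta>\<^sub>x + q \<delta>\<^sub>y\<close>, as the image of the weights \<open>p\<close>, \<open>q\<close> on two labels.\<close>

definition two_point_law :: "real \<Rightarrow> real \<Rightarrow> real \<Rightarrow> real \<Rightarrow> real measure" where
  "two_point_law p x q y =
     distr (point_measure {False, True} (\<lambda>b. ennreal (if b then q else p))) borel
       (\<lambda>b. if b then y else x)"

definition q_weight :: "real \<Rightarrow> real \<Rightarrow> real \<Rightarrow> real" where
  "q_weight \<beta> h a = (\<integral>x. exp (1/2 * A_second \<beta> h a * x ^ 2) \<partial>lborel)"

definition exp_nu :: "real \<Rightarrow> real" where
  "exp_nu a = (a * (1 - a)) powr (-1/2)"

text \<open>The weight of the phase \<open>a\<close> when the two phases are \<open>a\<close> and \<open>b\<close>.\<close>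

definition phase_weight :: "real \<Rightarrow> real \<Rightarrow> real \<Rightarrow> real \<Rightarrow> real" where
  "phase_weight \<beta> h a b =
     q_weight \<beta> h a * exp_nu a / (q_weight \<beta> h a * exp_nu a + q_weight \<beta> h b * exp_nu b)"


section \<open>Laws derived from the magnetization\<close>

definition density_law :: "real \<Rightarrow> real \<Rightarrow> nat \<Rightarrow> real measure" where
  "density_law \<beta> h n = distr (gibbs \<beta> h n) borel (\<lambda>\<omega>. magnetization n \<omega> / real n)"

definition fluctuation :: "nat \<Rightarrow> real \<Rightarrow> (nat \<Rightarrow> real) \<Rightarrow> real" where
  "fluctuation n m \<omega> = (magnetization n \<omega> - real n * m) / sqrt (real n)"

definition fluctuation_law :: "real \<Rightarrow> real \<Rightarrow> nat \<Rightarrow> real \<Rightarrow> real measure" where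
  "fluctuation_law \<beta> h n m = distr (gibbs \<beta> h n) borel (fluctuation n m)"

text \<open>\<open>uniform_measure M E\<close> is the conditional measure \<open>B \<mapsto> M (E \<inter> B) / M E\<close>.\<close>

definition cond_fluctuation_law :: "real \<Rightarrow> real \<Rightarrow> nat \<Rightarrow> real \<Rightarrow> real \<Rightarrow> real measure" where
  "cond_fluctuation_law \<beta> h n m \<delta> =
     distr (uniform_measure (gibbs \<beta> h n)
              {\<omega> \<in> space (gibbs \<beta> h n). \<bar>magnetization n \<omega> / real n - m\<bar> \<le> \<delta>})
       borel (fluctuation n m)"

end

theory Submission
  imports Defs
begin

text \<open>The law of the magnetization is that of \<open>2 K - n\<close>, where \<open>K\<close> has weights
  \<open>(n choose k) exp (n f(k/n))\<close>. By Stirling's formula these are, up to a factor independent of \<open>k\<close>,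
  \<open>(p (1 - p))\<^sup>-\<^sup>1\<^sup>/\<^sup>2 exp (n A(p)) (1 + O(1/n))\<close> with \<open>p = k/n\<close>. Near a 2-regular maximizer \<open>a\<close> a third-order
  Taylor expansion of \<open>A\<close> turns them into a Gaussian in \<open>y = (k - n a)/sqrt n\<close> with relative error
  \<open>O((1 + \<bar>y\<bar>)\<^sup>3/sqrt n)\<close>, so weighted sums of a Lipschitz function over the lattice of mesh \<open>1/sqrt n\<close>
  differ from the Gaussian integral by \<open>O(1/sqrt n)\<close>, uniformly in the function; this is the Wasserstein
  bound, and the constant function gives the mass of each phase. Away from the maximizers
  \<open>(n choose k) \<le> exp (n I(k/n))\<close> and compactness make the weights exponentially small.\<close>

section \<open>Stirling and entropy bounds for binomial coefficients\<close>

text \<open>The partition function is never evaluated: every probability and expectation is a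
  quotient of two sums of the same scaled weights, so all factors independent of k drop out. Two
  obstacles shape the estimates. The test functions of the Wasserstein distance are unbounded and
  form an infinite family, so errors are measured against one integrable envelope 1/(1+y^2); it
  absorbs their linear growth and keeps the constants independent of the function. Stirling's error
  is small only when k and n-k are both large, so the sharp weights serve only in windows inside
  (0,1) and a cruder bound covers the rest. For the unconditional law the far weights must moreover
  beat test functions as large as sqrt n, which their exponential smallness provides. Sum and
  integral are compared by reading the sum as the integral of a step function. The phase weights
  arise because both maximizers have the same value of A: exp(nA) cancels, and only the Gaussian
  masses q and the prefactors (a(1-a))^(-1/2) remain.\<close>

lemma ln_one_plus_bounds:
  fixes u :: real
  assumes "u \<ge> 0"
  shows "2 * u / (2 + u) \<le> ln (1 + u)" and "ln (1 + u) \<le> 2 * u / (2 + u) + u ^ 3 / 12"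
proof -
  have "ln (1 + 0) - 2 * 0 / (2 + 0) \<le> ln (1 + u) - 2 * u / (2 + u)"
  proof (rule DERIV_nonneg_imp_nondecreasing[OF assms])
    fix x :: real assume x: "0 \<le> x" "x \<le> u"
    have "((\<lambda>u. ln (1 + u) - 2 * u / (2 + u)) has_real_derivative
       (1 / (1 + x) - (2 * (2 + x) - 2 * x) / ((2 + x) * (2 + x)))) (at x)"
      using x by (auto intro!: derivative_eq_intros)
    \<comment> \<open>The derivative of the difference collapses to a square over a positive
      product. The same fraction returns in the second bound, where it is dominated by x^2/4, the
      derivative of x^3/12.\<close>
    moreover have "1 / (1 + x) - (2 * (2 + x) - 2 * x) / ((2 + x) * (2 + x)) = x\<^sup>2 / ((1 + x) * (2 + x)\<^sup>2)"
      using x by (simp add: divide_simps power2_eq_square) (simp add: algebra_simps)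
    moreover have "\<dots> \<ge> 0" using x by simp
    ultimately show "\<exists>y. ((\<lambda>u. ln (1 + u) - 2 * u / (2 + u)) has_real_derivative y) (at x) \<and> 0 \<le> y"
      by (intro exI conjI) (assumption, simp)
  qed
  then show "2 * u / (2 + u) \<le> ln (1 + u)" by simp
  have "2 * 0 / (2 + 0) + 0 ^ 3 / 12 - ln (1 + 0) \<le> 2 * u / (2 + u) + u ^ 3 / 12 - ln (1 + u)"
  proof (rule DERIV_nonneg_imp_nondecreasing[OF assms])
    fix x :: real assume x: "0 \<le> x" "x \<le> u"
    have "((\<lambda>u. 2 * u / (2 + u) + u ^ 3 / 12 - ln (1 + u)) has_real_derivative
       ((2 * (2 + x) - 2 * x) / ((2 + x) * (2 + x)) + 3 * x\<^sup>2 / 12 - 1 / (1 + x))) (at x)"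
      using x by (auto intro!: derivative_eq_intros)
    moreover have "(2 * (2 + x) - 2 * x) / ((2 + x) * (2 + x)) + 3 * x\<^sup>2 / 12 - 1 / (1 + x)
        = x\<^sup>2 / 4 - x\<^sup>2 / ((1 + x) * (2 + x)\<^sup>2)"
      using x by (simp add: divide_simps power2_eq_square) (simp add: algebra_simps)
    moreover have "x\<^sup>2 / 4 - x\<^sup>2 / ((1 + x) * (2 + x)\<^sup>2) \<ge> 0"
    proof -
      have "4 \<le> (1 + x) * (2 + x)\<^sup>2"
        using x by (simp add: power2_eq_square algebra_simps add_nonneg_nonneg)
      then have "x\<^sup>2 / ((1 + x) * (2 + x)\<^sup>2) \<le> x\<^sup>2 / 4"
        by (intro divide_left_mono) auto
      then show ?thesis by simp
    qed
    ultimately show "\<exists>y. ((\<lambda>u. 2 * u / (2 + u) + u ^ 3 / 12 - ln (1 + u)) has_real_derivative y) (at x) \<and> 0 \<le> y"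
      by (intro exI conjI) (assumption, simp)
  qed
  then show "ln (1 + u) \<le> 2 * u / (2 + u) + u ^ 3 / 12" by simp
qed

text \<open>Stirling's formula with an unspecified constant, which cancels in every ratio below.\<close>

lemma ln_fact_approx:
  obtains c :: real where
    "\<And>n. n \<ge> 1 \<Longrightarrow> \<bar>ln (fact n) - ((real n + 1/2) * ln (real n) - real n + c)\<bar> \<le> 1 / real n"
proof -
  \<comment> \<open>The logarithm of n! minus its main term, shifted to \<open>Suc n\<close> to
    avoid ln 0. It decreases while \<open>d n - 1 / real (Suc n)\<close> increases, so both share a
    limit, which is Stirling's constant, and lie within 1/n of it.\<close>
  define d where "d n = ln (fact (Suc n)) - (real (Suc n) + 1/2) * ln (real (Suc n)) + real (Suc n)" for n
  have step: "0 \<le> d n - d (Suc n) \<and> d n - d (Suc n) \<le> 1 / real (Suc n) - 1 / real (Suc (Suc n))" for n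
  proof -
    define m where "m = real (Suc n)"
    have m: "m \<ge> 1" by (simp add: m_def)
    have lf: "ln (fact (Suc (Suc n)) :: real) = ln (m + 1) + ln (fact (Suc n))"
    proof -
      have "(fact (Suc (Suc n)) :: real) = (m + 1) * fact (Suc n)"
        by (simp add: m_def)
      then show ?thesis using m by (simp add: ln_mult)
    qed
    have l1: "ln (m + 1) = ln m + ln (1 + 1 / m)"
    proof -
      have "m + 1 = m * (1 + 1 / m)" using m by (simp add: field_simps)
      moreover have "0 < 1 + 1 / m" using m by (simp add: add_pos_pos)
      ultimately show ?thesis using m ln_mult[of m "1 + 1 / m"] by simp
    qed
    have eq: "d n - d (Suc n) = (m + 1/2) * ln (1 + 1 / m) - 1"
    proof -
      have s: "real (Suc n) = m" "real (Suc (Suc n)) = m + 1" by (simp_all add: m_def)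
      show ?thesis unfolding d_def lf s l1 by (simp add: algebra_simps add_divide_distrib)
    qed
    have u: "1 / m \<ge> 0" using m by simp
    \<comment> \<open>The reason for comparing with 2u/(2+u): at u = 1/m it cancels the factor m +
      1/2 exactly, and only the cubic remainder is left.\<close>
    have e: "(m + 1/2) * (2 * (1/m) / (2 + 1/m)) = 1"
      using m by (simp add: divide_simps) 
    have lo: "1 \<le> (m + 1/2) * ln (1 + 1 / m)"
      using mult_left_mono[OF ln_one_plus_bounds(1)[OF u], of "m + 1/2"] m e by simp
    have hi1: "(m + 1/2) * ln (1 + 1 / m) - 1 \<le> (m + 1/2) * ((1/m) ^ 3 / 12)"
      using mult_left_mono[OF ln_one_plus_bounds(2)[OF u], of "m + 1/2"] m e
      by (simp add: distrib_left)
    \<comment> \<open>The left side is of order 1/(12 m^2). The telescoping majorant is cruder, but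
      sums to the final error 1/n at once.\<close>
    have hi2: "(m + 1/2) * ((1/m) ^ 3 / 12) \<le> 1 / m - 1 / (m + 1)"
    proof -
      have "(m + 1/2) * (m + 1) \<le> 12 * (m * m)"
      proof -
        have "m \<le> m * m" using m by (simp add: mult_left_le)
        moreover have "(m + 1/2) * (m + 1) = m * m + 3/2 * m + 1/2" by (simp add: field_simps)
        ultimately show ?thesis using m by linarith
      qed
      then have "(m + 1/2) * (m + 1) / (12 * m * m * m * (m + 1)) \<le> 12 * (m * m) / (12 * m * m * m * (m + 1))"
        using m by (intro divide_right_mono) auto
      moreover have "(m + 1/2) * (m + 1) / (12 * m * m * m * (m + 1)) = (m + 1/2) * ((1/m) ^ 3 / 12)"
        using m by (simp add: divide_simps power3_eq_cube)
      moreover have "12 * (m * m) / (12 * m * m * m * (m + 1)) = 1 / m - 1 / (m + 1)"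
        using m by (simp add: divide_simps)
      ultimately show ?thesis by simp
    qed
    have s: "real (Suc n) = m" "real (Suc (Suc n)) = m + 1" by (simp_all add: m_def)
    show ?thesis unfolding eq s using lo order_trans[OF hi1 hi2] by (intro conjI) (simp, assumption)
  qed
  have dec: "decseq d" using step by (intro decseq_SucI) simp
  have inc: "incseq (\<lambda>n. d n - 1 / real (Suc n))"
  proof (rule incseq_SucI)
    fix n show "d n - 1 / real (Suc n) \<le> d (Suc n) - 1 / real (Suc (Suc n))"
      using step[of n] by linarith
  qed
  have lower: "d 0 - 1 \<le> d n" for n
  proof -
    have "d 0 - 1 / real (Suc 0) \<le> d n - 1 / real (Suc n)"
      using incseqD[OF inc, of 0 n] by simp
    moreover have "0 \<le> 1 / real (Suc n)" "1 / real (Suc 0) = 1" by simp_all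
    ultimately show ?thesis by linarith
  qed
  obtain c where c: "d \<longlonglongrightarrow> c" "\<And>n. c \<le> d n"
    using decseq_convergent[OF dec, of "d 0 - 1"] lower by blast
  have "(\<lambda>n. d n - 1 / real (Suc n)) \<longlonglongrightarrow> c - 0"
    using c(1) LIMSEQ_Suc[OF lim_1_over_n] by (intro tendsto_diff) auto
  then have up: "d n - 1 / real (Suc n) \<le> c" for n
    using incseq_le[OF inc, of "c - 0"] by simp
  show thesis
  proof (rule that)
    fix n :: nat assume "n \<ge> 1"
    then obtain m where n: "n = Suc m" by (cases n) auto
    show "\<bar>ln (fact n) - ((real n + 1/2) * ln (real n) - real n + c)\<bar> \<le> 1 / real n"
      using c(2)[of m] up[of m] unfolding n d_def by linarith
  qed
qed

text \<open>Three uses of Stirling's formula. The constant enters once with plus and twice with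
  minus, whence the single -c; the three errors add, so the bound degrades when k or n-k is
  small.\<close>

lemma ln_binomial_approx:
  obtains c :: real where
    "\<And>n k. 0 < k \<Longrightarrow> k < n \<Longrightarrow>
       \<bar>ln (real (n choose k)) - (real n * entropy_fun (real k / real n)
          - ln (real k / real n * (1 - real k / real n)) / 2 - ln (real n) / 2 - c)\<bar>
       \<le> 1 / real n + 1 / real k + 1 / real (n - k)"
proof -
  obtain c where c: "\<And>n. n \<ge> 1 \<Longrightarrow>
      \<bar>ln (fact n) - ((real n + 1/2) * ln (real n) - real n + c)\<bar> \<le> 1 / real n"
    using ln_fact_approx by blast
  show thesis
  proof (rule that)
    fix n k :: nat assume k: "0 < k" "k < n"
    define p where "p = real k / real n"
    have p: "0 < p" "p < 1" using k by (auto simp: p_def)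
    have kn: "real k = p * real n" and nk: "real (n - k) = (1 - p) * real n"
      using k by (auto simp: p_def of_nat_diff field_simps)
    have lk: "ln (real k) = ln p + ln (real n)" and lnk: "ln (real (n - k)) = ln (1 - p) + ln (real n)"
      unfolding kn nk using p k by (auto simp: ln_mult)
    have "real (n choose k) = fact n / (fact k * fact (n - k))"
      using k by (simp add: binomial_fact)
    then have b: "ln (real (n choose k)) = ln (fact n) - ln (fact k) - ln (fact (n - k))"
      by (simp add: ln_div ln_mult)
    have lp: "ln (p * (1 - p)) = ln p + ln (1 - p)" using p by (simp add: ln_mult)
    have id: "((real n + 1/2) * ln (real n) - real n + c) - ((real k + 1/2) * ln (real k) - real k + c)
       - ((real (n - k) + 1/2) * ln (real (n - k)) - real (n - k) + c)
      = real n * entropy_fun p - ln (p * (1 - p)) / 2 - ln (real n) / 2 - c"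
    proof -
      \<comment> \<open>With k = pn the terms n ln n cancel because k + (n-k) = n. What remains is
        the entropy and, from the shifts by 1/2, the two logarithmic corrections.\<close>
      have "((N + 1/2) * L - N + c) - ((p * N + 1/2) * (P + L) - p * N + c)
          - (((1 - p) * N + 1/2) * (Q + L) - (1 - p) * N + c)
          = N * (- p * P - (1 - p) * Q) - (P + Q) / 2 - L / 2 - c" for N L P Q :: real
        by (simp add: algebra_simps add_divide_distrib)
      from this[of "real n" "ln (real n)" "ln p" "ln (1 - p)"] show ?thesis
        unfolding lk lnk lp entropy_fun_def by (simp only: kn nk)
    qed
    have "1 \<le> n" "1 \<le> k" "1 \<le> n - k" using k by auto
    have comb: "\<bar>x - R\<bar> \<le> e1 + e2 + e3"
      if "\<bar>y1 - Y1\<bar> \<le> e1" "\<bar>y2 - Y2\<bar> \<le> e2" "\<bar>y3 - Y3\<bar> \<le> e3"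
        "Y1 - Y2 - Y3 = R" "x = y1 - y2 - y3" for x R e1 e2 e3 y1 y2 y3 Y1 Y2 Y3 :: real
      using that by linarith
    from comb[OF c[OF \<open>1 \<le> n\<close>] c[OF \<open>1 \<le> k\<close>] c[OF \<open>1 \<le> n - k\<close>] id b]
    show "\<bar>ln (real (n choose k)) - (real n * entropy_fun (real k / real n)
          - ln (real k / real n * (1 - real k / real n)) / 2 - ln (real n) / 2 - c)\<bar>
       \<le> 1 / real n + 1 / real k + 1 / real (n - k)"
      unfolding p_def[symmetric] .
  qed
qed

text \<open>At p = k/n the k-th term of the expansion of (p + (1-p))^n = 1 is at most 1, and p^k
  (1-p)^(n-k) is exp(-n I(p)). There is no error term, so the bound is uniform up to the edges k = 0
  and k = n.\<close>

lemma binomial_le_exp_entropy: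
  assumes "k \<le> n"
  shows "real (n choose k) \<le> exp (real n * entropy_fun (real k / real n))"
proof (cases "k = 0 \<or> k = n")
  case True
  then show ?thesis by (cases "n = 0") (auto simp: entropy_fun_def)
next
  case False
  with assms have k: "0 < k" "k < n" by auto
  define p where "p = real k / real n"
  have p: "0 < p" "p < 1" using k by (auto simp: p_def)
  have kn: "real k = p * real n" and nk: "real (n - k) = (1 - p) * real n"
    using k by (auto simp: p_def of_nat_diff field_simps)
  have "real (n choose k) * p ^ k * (1 - p) ^ (n - k) \<le> (\<Sum>k\<le>n. real (n choose k) * p ^ k * (1 - p) ^ (n - k))"
    using assms p by (intro member_le_sum) auto
  also have "\<dots> = (p + (1 - p)) ^ n" by (rule binomial_ring[symmetric])
  finally have 1: "real (n choose k) * (p ^ k * (1 - p) ^ (n - k)) \<le> 1" by (simp add: mult.assoc)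
  have "p ^ k * (1 - p) ^ (n - k) = exp (real k * ln p) * exp (real (n - k) * ln (1 - p))"
    using p by (simp add: exp_of_nat_mult)
  also have "\<dots> = exp (- (real n * entropy_fun p))"
    unfolding kn nk by (simp add: exp_add[symmetric] entropy_fun_def algebra_simps)
  finally have "real (n choose k) * exp (- (real n * entropy_fun p)) \<le> 1" using 1 by simp
  from mult_right_mono[OF this, of "exp (real n * entropy_fun p)"] show ?thesis
    unfolding p_def[symmetric] by (simp add: mult.assoc exp_add[symmetric])
qed

section \<open>Local expansion of the variational functional\<close>

text \<open>The first three derivatives of A on (0,1) in closed form, as Taylor's theorem requires;
  \<open>A_second\<close> is an iterated \<open>deriv\<close> and is identified with the second one
  below.\<close>

definition A_d1 :: "real \<Rightarrow> real \<Rightarrow> real \<Rightarrow> real" where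
  "A_d1 \<beta> h x = 6 * \<beta> * (2 * x - 1)\<^sup>2 + 4 * h * (2 * x - 1) + ln (1 - x) - ln x"

definition A_d2 :: "real \<Rightarrow> real \<Rightarrow> real \<Rightarrow> real" where
  "A_d2 \<beta> h x = 24 * \<beta> * (2 * x - 1) + 8 * h - 1 / x - 1 / (1 - x)"

definition A_d3 :: "real \<Rightarrow> real \<Rightarrow> real" where
  "A_d3 \<beta> x = 48 * \<beta> + 1 / x\<^sup>2 - 1 / (1 - x)\<^sup>2"

lemma has_derivative_A_fun:
  assumes "0 < x" "x < 1"
  shows "(A_fun \<beta> h has_real_derivative A_d1 \<beta> h x) (at x)"
proof -
  have 1: "((\<lambda>x. \<beta> * (2 * x - 1) ^ 3 + h * (2 * x - 1) ^ 2) has_real_derivative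
      6 * \<beta> * (2 * x - 1)\<^sup>2 + 4 * h * (2 * x - 1)) (at x)"
    by (auto intro!: derivative_eq_intros)
  have 2: "((\<lambda>x. - x * ln x) has_real_derivative - ln x - 1) (at x)"
    using assms by (auto intro!: derivative_eq_intros)
  have 3: "((\<lambda>x. (1 - x) * ln (1 - x)) has_real_derivative - ln (1 - x) - 1) (at x)"
    using assms by (auto intro!: derivative_eq_intros)
  show ?thesis
    unfolding A_fun_def f_cubic_def entropy_fun_def
    using DERIV_add[OF 1 DERIV_diff[OF 2 3]] by (simp add: A_d1_def algebra_simps)
qed

lemma has_derivative_A_d1:
  assumes "0 < x" "x < 1"
  shows "(A_d1 \<beta> h has_real_derivative A_d2 \<beta> h x) (at x)"
  unfolding A_d1_def A_d2_def
  using assms by (auto intro!: derivative_eq_intros simp: field_simps)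

lemma has_derivative_A_d2:
  assumes "0 < x" "x < 1"
  shows "(A_d2 \<beta> h has_real_derivative A_d3 \<beta> x) (at x)"
  unfolding A_d2_def A_d3_def
  using assms by (auto intro!: derivative_eq_intros simp: power2_eq_square field_simps)

text \<open>The inner \<open>deriv\<close> has its closed form only on (0,1), so the derivative is
  transferred along this open set.\<close>

lemma A_second_eq:
  assumes "0 < x" "x < 1"
  shows "A_second \<beta> h x = A_d2 \<beta> h x"
proof -
  have "(deriv (A_fun \<beta> h) has_real_derivative A_d2 \<beta> h x) (at x)"
    by (rule has_field_derivative_transform_within_open[OF has_derivative_A_d1, of _ "{0<..<1}"])
      (use assms in \<open>auto intro!: DERIV_imp_deriv[symmetric] has_derivative_A_fun\<close>)
  then show ?thesis unfolding A_second_def by (rule DERIV_imp_deriv)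
qed

text \<open>At 0 the right-hand limit 0 is also the value, since the factor 0 annihilates ln 0. This
  makes A continuous on the closed interval, as the compactness argument needs.\<close>

lemma continuous_on_mult_ln: "continuous_on {0::real..} (\<lambda>x. x * ln x)"
proof (rule continuous_on_eq_continuous_within[THEN iffD2], intro ballI)
  fix x :: real assume "x \<in> {0..}"
  then consider "x = 0" | "x > 0" by fastforce
  then show "continuous (at x within {0..}) (\<lambda>x. x * ln x)"
  proof cases
    case 1
    have "((\<lambda>x::real. x * ln x) \<longlongrightarrow> 0) (at_right 0)" by real_asymp
    then show ?thesis using 1 by (simp add: continuous_within at_within_Ici_at_right)
  next
    case 2
    then show ?thesis by (intro continuous_intros) auto
  qed
qed

lemma continuous_on_A_fun: "continuous_on {0..1} (A_fun \<beta> h)"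
proof -
  have 1: "continuous_on {0..1::real} (\<lambda>x. x * ln x)"
    by (rule continuous_on_subset[OF continuous_on_mult_ln]) auto
  have 2: "continuous_on {0..1::real} (\<lambda>x. (1 - x) * ln (1 - x))"
    by (rule continuous_on_compose2[OF continuous_on_mult_ln, of _ "\<lambda>x. 1 - x"])
      (auto intro!: continuous_intros)
  have "A_fun \<beta> h = (\<lambda>x. f_cubic \<beta> h x - x * ln x - (1 - x) * ln (1 - x))"
    by (auto simp: A_fun_def entropy_fun_def)
  then show ?thesis unfolding f_cubic_def
    using 1 2 by (auto intro!: continuous_intros)
qed

lemma A_fun_taylor:
  assumes a: "0 < r" "0 < a - r" "a + r < 1" and crit: "A_d1 \<beta> h a = 0"
  obtains M where "M \<ge> 0"
    "\<And>x. \<bar>x - a\<bar> \<le> r \<Longrightarrow> \<bar>A_fun \<beta> h x - A_fun \<beta> h a - A_d2 \<beta> h a / 2 * (x - a)\<^sup>2\<bar> \<le> M * \<bar>x - a\<bar> ^ 3"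
proof
  \<comment> \<open>One sixth of a bound for the third derivative on [a-r, a+r]: 1/t^2 is largest at
    the left end, 1/(1-t)^2 at the right end.\<close>
  define M where "M = (48 * \<bar>\<beta>\<bar> + 1 / (a - r)\<^sup>2 + 1 / (1 - (a + r))\<^sup>2) / 6"
  show "M \<ge> 0" by (simp add: M_def)
  fix x assume x: "\<bar>x - a\<bar> \<le> r"
  show "\<bar>A_fun \<beta> h x - A_fun \<beta> h a - A_d2 \<beta> h a / 2 * (x - a)\<^sup>2\<bar> \<le> M * \<bar>x - a\<bar> ^ 3"
  proof (cases "x = a")
    case False
    define D where "D m = (if m = 0 then A_fun \<beta> h else if m = 1 then A_d1 \<beta> h
      else if m = 2 then A_d2 \<beta> h else A_d3 \<beta>)" for m :: nat
    have "\<exists>t. (if x < a then x < t \<and> t < a else a < t \<and> t < x) \<and>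
      A_fun \<beta> h x = (\<Sum>m<3. (D m a / fact m) * (x - a) ^ m) + (D 3 t / fact 3) * (x - a) ^ 3"
    proof (rule Taylor[where a = "a - r" and b = "a + r"])
      show "\<forall>m t. m < 3 \<and> a - r \<le> t \<and> t \<le> a + r \<longrightarrow> (D m has_real_derivative D (Suc m) t) (at t)"
      proof (intro allI impI)
        fix m :: nat and t assume t: "m < 3 \<and> a - r \<le> t \<and> t \<le> a + r"
        then have t': "0 < t" "t < 1" using a by linarith+
        from t consider "m = 0" | "m = 1" | "m = 2" by linarith
        then show "(D m has_real_derivative D (Suc m) t) (at t)"
        proof cases
        qed (simp_all add: D_def t' has_derivative_A_fun has_derivative_A_d1 has_derivative_A_d2)
      qed
    qed (use a x False in \<open>auto simp: D_def\<close>)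
    then obtain t where t': "if x < a then x < t \<and> t < a else a < t \<and> t < x"
      and eq: "A_fun \<beta> h x = (\<Sum>m<3. (D m a / fact m) * (x - a) ^ m) + (D 3 t / fact 3) * (x - a) ^ 3"
      by blast
    from t' x have t: "\<bar>t - a\<bar> \<le> r" by (cases "x < a") (simp_all add: abs_le_iff)
    have "A_fun \<beta> h x - A_fun \<beta> h a - A_d2 \<beta> h a / 2 * (x - a)\<^sup>2 = A_d3 \<beta> t / 6 * (x - a) ^ 3"
      using eq crit by (simp add: D_def eval_nat_numeral)
    then have eq': "\<bar>A_fun \<beta> h x - A_fun \<beta> h a - A_d2 \<beta> h a / 2 * (x - a)\<^sup>2\<bar> = \<bar>A_d3 \<beta> t\<bar> / 6 * \<bar>x - a\<bar> ^ 3"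
      by (simp only: abs_mult power_abs abs_divide abs_numeral)
    have "\<bar>A_d3 \<beta> t\<bar> \<le> 6 * M"
    proof -
      have t': "a - r \<le> t" "1 - (a + r) \<le> 1 - t" using t by linarith+
      have "1 / t\<^sup>2 \<le> 1 / (a - r)\<^sup>2"
        using t' a by (intro divide_left_mono power_mono mult_pos_pos) auto
      moreover have "1 / (1 - t)\<^sup>2 \<le> 1 / (1 - (a + r))\<^sup>2"
        using t' a by (intro divide_left_mono power_mono mult_pos_pos) auto
      moreover have "0 \<le> 1 / t\<^sup>2" "0 \<le> 1 / (1 - t)\<^sup>2" by simp_all
      moreover have "\<bar>48 * b + x - y\<bar> \<le> 6 * ((48 * \<bar>b\<bar> + X + Y) / 6)"
        if "x \<le> X" "y \<le> Y" "0 \<le> x" "0 \<le> y" for b x y X Y :: real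
      proof (rule abs_leI)
        have "48 * b \<le> 48 * \<bar>b\<bar>" "- (48 * b) \<le> 48 * \<bar>b\<bar>" by simp_all
        then show "48 * b + x - y \<le> 6 * ((48 * \<bar>b\<bar> + X + Y) / 6)"
          "- (48 * b + x - y) \<le> 6 * ((48 * \<bar>b\<bar> + X + Y) / 6)"
          using that by simp_all
      qed
      ultimately show ?thesis unfolding M_def A_d3_def by blast
    qed
    then show ?thesis
      unfolding eq' by (intro mult_right_mono) auto
  qed simp
qed

section \<open>Gaussian form of the weights near a 2-regular maximizer\<close>

definition stirling_const :: real where
  "stirling_const = (SOME c. \<forall>n k. 0 < k \<longrightarrow> k < n \<longrightarrow>
       \<bar>ln (real (n choose k)) - (real n * entropy_fun (real k / real n)
          - ln (real k / real n * (1 - real k / real n)) / 2 - ln (real n) / 2 - c)\<bar>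
       \<le> 1 / real n + 1 / real k + 1 / real (n - k))"

text \<open>Fixing the constant once by choice lets it occur in the definition of the scaled
  weights. Its value is ln (sqrt (2 pi)), but only its existence is used.\<close>

lemma ln_binomial_stirling:
  assumes "0 < k" "k < n"
  shows "\<bar>ln (real (n choose k)) - (real n * entropy_fun (real k / real n)
          - ln (real k / real n * (1 - real k / real n)) / 2 - ln (real n) / 2 - stirling_const)\<bar>
       \<le> 1 / real n + 1 / real k + 1 / real (n - k)"
proof -
  obtain c where "\<forall>n k. 0 < k \<longrightarrow> k < n \<longrightarrow>
       \<bar>ln (real (n choose k)) - (real n * entropy_fun (real k / real n)
          - ln (real k / real n * (1 - real k / real n)) / 2 - ln (real n) / 2 - c)\<bar>
       \<le> 1 / real n + 1 / real k + 1 / real (n - k)"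
    using ln_binomial_approx by blast
  from someI[where P = "\<lambda>c. \<forall>n k. 0 < k \<longrightarrow> k < n \<longrightarrow>
       \<bar>ln (real (n choose k)) - (real n * entropy_fun (real k / real n)
          - ln (real k / real n * (1 - real k / real n)) / 2 - ln (real n) / 2 - c)\<bar>
       \<le> 1 / real n + 1 / real k + 1 / real (n - k)", OF this] assms
  show ?thesis unfolding stirling_const_def by blast
qed

definition weight :: "real \<Rightarrow> real \<Rightarrow> nat \<Rightarrow> nat \<Rightarrow> real" where
  "weight \<beta> h n k = real (n choose k) * exp (real n * f_cubic \<beta> h (real k / real n))"

text \<open>Normalized so that the weights at distance of order \<open>1/sqrt n\<close> from a maximizer \<open>a\<close> converge to
  \<open>exp_nu a\<close> times a Gaussian factor. All
  maximizers share the value of \<open>A\<close>, hence the same scaled weights.\<close>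

definition scaled_weight :: "real \<Rightarrow> real \<Rightarrow> real \<Rightarrow> nat \<Rightarrow> nat \<Rightarrow> real" where
  "scaled_weight \<beta> h a n k =
     exp stirling_const * sqrt (real n) * exp (- real n * A_fun \<beta> h a) * weight \<beta> h n k"

lemma scaled_weight_nonneg: "scaled_weight \<beta> h a n k \<ge> 0"
  by (simp add: scaled_weight_def weight_def)

lemma scaled_weight_pos: "n \<ge> 1 \<Longrightarrow> k \<le> n \<Longrightarrow> scaled_weight \<beta> h a n k > 0"
  by (simp add: scaled_weight_def weight_def)

lemma ln_scaled_weight:
  assumes "0 < k" "k < n"
  shows "\<bar>ln (scaled_weight \<beta> h a n k) - (real n * (A_fun \<beta> h (real k / real n) - A_fun \<beta> h a)
      - ln (real k / real n * (1 - real k / real n)) / 2)\<bar> \<le> 1 / real n + 1 / real k + 1 / real (n - k)"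
proof -
  have "ln (scaled_weight \<beta> h a n k) = stirling_const + ln (real n) / 2 - real n * A_fun \<beta> h a
      + ln (real (n choose k)) + real n * f_cubic \<beta> h (real k / real n)"
    unfolding scaled_weight_def weight_def using assms
    by (simp add: ln_mult ln_sqrt)
  moreover have "real n * (A_fun \<beta> h (real k / real n) - A_fun \<beta> h a) =
     real n * entropy_fun (real k / real n) + real n * f_cubic \<beta> h (real k / real n) - real n * A_fun \<beta> h a"
    by (simp add: A_fun_def algebra_simps)
  ultimately have "ln (scaled_weight \<beta> h a n k) - (real n * (A_fun \<beta> h (real k / real n) - A_fun \<beta> h a)
      - ln (real k / real n * (1 - real k / real n)) / 2)
    = ln (real (n choose k)) - (real n * entropy_fun (real k / real n)
          - ln (real k / real n * (1 - real k / real n)) / 2 - ln (real n) / 2 - stirling_const)"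
    by (simp only:)
  then show ?thesis using ln_binomial_stirling[OF assms] by (simp only:)
qed

text \<open>From 1 + x \<le> exp x. Keeping the factor exp (max u v) instead of a constant preserves
  the Gaussian decay when both exponents are bounded by a negative quadratic.\<close>

lemma abs_exp_diff_le:
  fixes u v :: real
  shows "\<bar>exp u - exp v\<bar> \<le> \<bar>u - v\<bar> * exp (max u v)"
proof -
  have "exp y - exp x \<le> (y - x) * exp y" if "x \<le> y" for x y :: real
  proof -
    have "1 + (x - y) \<le> exp (x - y)" by (rule exp_ge_add_one_self)
    then have "(1 + (x - y)) * exp y \<le> exp (x - y) * exp y" by (intro mult_right_mono) auto
    then show ?thesis by (simp add: exp_add[symmetric] algebra_simps)
  qed
  from this[of u v] this[of v u] show ?thesis by (cases "u \<le> v") (auto simp: max_def)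
qed

lemma ln_diff_bound:
  fixes x y d :: real
  assumes "0 < d" "d \<le> x" "d \<le> y"
  shows "\<bar>ln x - ln y\<bar> \<le> \<bar>x - y\<bar> / d"
proof -
  have *: "ln u - ln v \<le> \<bar>u - v\<bar> / d" if "d \<le> u" "d \<le> v" for u v
  proof -
    have uv: "0 < u" "0 < v" using that assms by linarith+
    have "ln u - ln v = ln (u / v)" using uv by (simp add: ln_div)
    also have "\<dots> \<le> u / v - 1" using uv by (intro ln_le_minus_one) simp
    also have "\<dots> = (u - v) / v" using uv by (simp add: field_simps)
    also have "\<dots> \<le> \<bar>u - v\<bar> / v" using uv by (intro divide_right_mono) auto
    also have "\<dots> \<le> \<bar>u - v\<bar> / d" using that assms uv by (intro divide_left_mono) auto
    finally show ?thesis .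
  qed
  from *[OF assms(2,3)] *[OF assms(3,2)] show ?thesis by (simp add: abs_le_iff abs_minus_commute)
qed

lemma exp_nu_eq: "0 < a \<Longrightarrow> a < 1 \<Longrightarrow> exp_nu a = exp (- (ln (a * (1 - a)) / 2))"
  by (simp add: exp_nu_def powr_def)

text \<open>Both the scaled weight and its Gaussian limit are written as exponentials, exp u and exp
  v. The cubic Taylor remainder is used twice: divided by sqrt n it bounds |u - v|, and absorbed
  into half of the quadratic term it bounds max u v by a constant minus \<kappa> z^2.\<close>

lemma scaled_weight_local:
  assumes a: "0 < a" "a < 1" and crit: "A_d1 \<beta> h a = 0" and neg: "A_second \<beta> h a < 0"
  obtains r0 \<kappa> C where "0 < r0" "r0 < a" "a + r0 < 1" "0 < \<kappa>" "C \<ge> 0"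
    "\<And>n k. 1 \<le> n \<Longrightarrow> \<bar>real k / real n - a\<bar> \<le> r0 \<Longrightarrow>
       \<bar>scaled_weight \<beta> h a n k - exp_nu a * exp (1/2 * A_second \<beta> h a * ((real k - real n * a) / sqrt (real n))\<^sup>2)\<bar>
       \<le> C / sqrt (real n) * (1 + \<bar>(real k - real n * a) / sqrt (real n)\<bar>) ^ 3
          * exp (- \<kappa> * ((real k - real n * a) / sqrt (real n))\<^sup>2)"
proof -
  define s where "s = A_second \<beta> h a"
  have s: "s < 0" "A_d2 \<beta> h a = s" using neg A_second_eq[OF a] by (simp_all add: s_def)
  \<comment> \<open>Within distance d of a both p and 1-p are at least d, which bounds the Stirling
    error by a multiple of 1/n and makes the logarithmic prefactor Lipschitz.\<close>
  define d where "d = min a (1 - a) / 2"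
  have d: "0 < d" "2 * d \<le> a" "2 * d \<le> 1 - a" "d < 1" using a by (auto simp: d_def min_def)
  obtain M where M: "M \<ge> 0" "\<And>x. \<bar>x - a\<bar> \<le> d \<Longrightarrow>
      \<bar>A_fun \<beta> h x - A_fun \<beta> h a - s / 2 * (x - a)\<^sup>2\<bar> \<le> M * \<bar>x - a\<bar> ^ 3"
    using A_fun_taylor[of d a \<beta> h] d crit s by auto
  \<comment> \<open>Half of the decay rate -s/2: the other half is reserved for the cubic
    remainder.\<close>
  define \<kappa> where "\<kappa> = - s / 4"
  have \<kappa>: "\<kappa> > 0" "s / 2 = - 2 * \<kappa>" using s by (simp_all add: \<kappa>_def)
  \<comment> \<open>The second entry yields M |p-a| \<le> \<kappa>, so the remainder costs at most
    \<kappa> z^2; the denominator M + 1 covers M = 0.\<close>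
  define r0 where "r0 = min d (\<kappa> / (M + 1))"
  have r0: "0 < r0" "r0 \<le> d" "M * r0 \<le> \<kappa>"
  proof -
    show "0 < r0" "r0 \<le> d" using d \<kappa> M by (auto simp: r0_def)
    have "M * r0 \<le> M * (\<kappa> / (M + 1))" using M by (intro mult_left_mono) (auto simp: r0_def)
    also have "\<dots> \<le> \<kappa>" using M \<kappa> by (simp add: divide_simps)
    finally show "M * r0 \<le> \<kappa>" .
  qed
  define l where "l p = - (ln (p * (1 - p)) / 2)" for p :: real
  have l: "\<bar>l p - l a\<bar> \<le> \<bar>p - a\<bar> / d" if "d \<le> p" "d \<le> 1 - p" for p
  proof -
    have p: "0 < p" "0 < 1 - p" using that d by linarith+
    have "l p = - ((ln p + ln (1 - p)) / 2)" "l a = - ((ln a + ln (1 - a)) / 2)"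
      unfolding l_def using p a by (simp_all add: ln_mult)
    moreover have "\<bar>ln p - ln a\<bar> \<le> \<bar>p - a\<bar> / d" "\<bar>ln (1 - p) - ln (1 - a)\<bar> \<le> \<bar>(1 - p) - (1 - a)\<bar> / d"
      using d that by (intro ln_diff_bound; linarith)+
    moreover have "\<bar>(1 - p) - (1 - a)\<bar> = \<bar>p - a\<bar>" by linarith
    ultimately show ?thesis by (simp add: field_simps)
  qed
  define R where "R = 1 + 2 / d"
  have R: "R \<ge> 0" using d by (simp add: R_def)
  \<comment> \<open>In the exponent, 1 bounds the variation |p-a|/d of the logarithmic prefactor and
    R the Stirling error.\<close>
  define C where "C = (M + 1 / d + R) * exp (max (l a) (l a + 1 + R))"
  have le1: "1 / d \<ge> 0" using d by simp
  show thesis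
  proof (rule that[of r0 \<kappa> C])
    show "0 < r0" "r0 < a" "a + r0 < 1" "0 < \<kappa>" "C \<ge> 0"
      using r0 d a \<kappa> M R le1 by (auto simp: C_def)
    fix n k :: nat
    assume n: "1 \<le> n" and near: "\<bar>real k / real n - a\<bar> \<le> r0"
    define p where "p = real k / real n"
    define N where "N = real n"
    define z where "z = (real k - real n * a) / sqrt (real n)"
    have N: "N \<ge> 1" "N > 0" "sqrt N \<ge> 1" "sqrt N > 0" using n by (auto simp: N_def)
    have zp: "p - a = z / sqrt N" and zp2: "N * (p - a)\<^sup>2 = z\<^sup>2"
    proof -
      have "real k - real n * a = N * (p - a)" using N by (simp add: p_def N_def algebra_simps)
      then have z: "z = N * (p - a) / sqrt N" by (simp add: z_def N_def)
      also have "\<dots> = sqrt N * (p - a)" using N by (simp add: real_div_sqrt field_simps)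
      finally have z': "z = sqrt N * (p - a)" .
      then show "p - a = z / sqrt N" using N by simp
      show "N * (p - a)\<^sup>2 = z\<^sup>2" unfolding z' using N by (simp add: power_mult_distrib)
    qed
    have pa: "\<bar>p - a\<bar> \<le> r0" using near by (simp add: p_def)
    have pd: "d \<le> p" "d \<le> 1 - p" using pa r0 d by linarith+
    have kn: "0 < k" "k < n"
    proof -
      show "0 < k" using pd d by (intro Nat.gr0I) (auto simp: p_def)
      have "p < 1" using pd d by linarith
      then show "k < n" using n by (simp add: p_def)
    qed
    define u where "u = ln (scaled_weight \<beta> h a n k)"
    have eu: "scaled_weight \<beta> h a n k = exp u"
      using scaled_weight_pos[of n k \<beta> h a] kn by (simp add: u_def)
    define v where "v = l a + s / 2 * z\<^sup>2"
    have ev: "exp_nu a * exp (1/2 * A_second \<beta> h a * z\<^sup>2) = exp v"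
      unfolding exp_nu_eq[OF a] v_def l_def s_def[symmetric] by (simp add: exp_add[symmetric])
    have err: "\<bar>u - (N * (A_fun \<beta> h p - A_fun \<beta> h a) + l p)\<bar> \<le> R / N"
    proof -
      have "1 / real k \<le> 1 / (d * N)"
        using pd d N kn by (intro divide_left_mono) (auto simp: p_def N_def field_simps)
      moreover have "1 / real (n - k) \<le> 1 / (d * N)"
      proof (intro divide_left_mono)
        have "d * N \<le> (1 - p) * N" using pd N by (intro mult_right_mono) auto
        also have "\<dots> = real (n - k)" using kn by (simp add: p_def N_def of_nat_diff field_simps)
        finally show "d * N \<le> real (n - k)" .
      qed (use kn d N in auto)
      moreover have "R / N = 1 / N + 1 / (d * N) + 1 / (d * N)"
        using d N by (simp add: R_def field_simps)
      ultimately have le: "1 / real n + 1 / real k + 1 / real (n - k) \<le> R / N"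
        by (metis N_def add_mono order_refl)
      have "u - (N * (A_fun \<beta> h p - A_fun \<beta> h a) + l p) =
        ln (scaled_weight \<beta> h a n k) - (real n * (A_fun \<beta> h (real k / real n) - A_fun \<beta> h a)
        - ln (real k / real n * (1 - real k / real n)) / 2)"
        by (simp add: u_def N_def p_def l_def)
      then show ?thesis using order_trans[OF ln_scaled_weight[OF kn, of \<beta> h a] le] by (simp only:)
    qed
    have tay: "\<bar>N * (A_fun \<beta> h p - A_fun \<beta> h a) - s / 2 * z\<^sup>2\<bar> \<le> M * (N * \<bar>p - a\<bar> ^ 3)"
    proof -
      have "\<bar>A_fun \<beta> h p - A_fun \<beta> h a - s / 2 * (p - a)\<^sup>2\<bar> \<le> M * \<bar>p - a\<bar> ^ 3"
        using M(2)[of p] pa r0 by linarith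
      then have "N * \<bar>A_fun \<beta> h p - A_fun \<beta> h a - s / 2 * (p - a)\<^sup>2\<bar> \<le> N * (M * \<bar>p - a\<bar> ^ 3)"
        using N by (intro mult_left_mono) auto
      moreover have "N * \<bar>A_fun \<beta> h p - A_fun \<beta> h a - s / 2 * (p - a)\<^sup>2\<bar>
        = \<bar>N * (A_fun \<beta> h p - A_fun \<beta> h a) - s / 2 * z\<^sup>2\<bar>"
        unfolding zp2[symmetric] using N
        by (subst abs_of_pos[of N, symmetric], simp, subst abs_mult[symmetric]) (simp add: algebra_simps)
      ultimately show ?thesis by (simp add: algebra_simps)
    qed
    \<comment> \<open>The form used twice: the factor |p-a| is turned into |z|/sqrt n for the rate
      and bounded by r0 for the decay.\<close>
    have cub: "N * \<bar>p - a\<bar> ^ 3 = \<bar>p - a\<bar> * z\<^sup>2"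
      unfolding zp2[symmetric] by (simp add: power3_eq_cube power2_eq_square)
    have labs: "\<bar>l p - l a\<bar> \<le> \<bar>p - a\<bar> / d" by (rule l[OF pd])
    have pz: "\<bar>p - a\<bar> = \<bar>z\<bar> / sqrt N" unfolding zp using N by (simp add: abs_divide)
    have RN: "R / N \<le> R / sqrt N" "R / N \<le> R"
    proof -
      have "sqrt N \<le> N" using N by (simp add: real_le_lsqrt power2_eq_square)
      then show "R / N \<le> R / sqrt N" using R N by (intro divide_left_mono) auto
      show "R / N \<le> R" using R N by (simp add: divide_le_eq mult_le_cancel_left1)
    qed
    have uv: "\<bar>u - v\<bar> \<le> (M + 1 / d + R) / sqrt N * (1 + \<bar>z\<bar>) ^ 3"
    proof -
      have "\<bar>u - v\<bar> \<le> M * (\<bar>p - a\<bar> * z\<^sup>2) + \<bar>p - a\<bar> / d + R / N"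
        using err tay labs unfolding cub v_def by linarith
      also have "\<dots> \<le> M * (\<bar>z\<bar> / sqrt N * z\<^sup>2) + \<bar>z\<bar> / sqrt N / d + R / sqrt N"
        unfolding pz using RN by simp
      also have "\<dots> = (M * \<bar>z\<bar> ^ 3 + 1 / d * \<bar>z\<bar> + R) / sqrt N"
        by (simp add: add_divide_distrib power3_eq_cube power2_eq_square mult_ac)
      also have "\<dots> \<le> (M * (1 + \<bar>z\<bar>) ^ 3 + 1 / d * (1 + \<bar>z\<bar>) ^ 3 + R * (1 + \<bar>z\<bar>) ^ 3) / sqrt N"
      proof (intro divide_right_mono add_mono mult_left_mono)
        show "\<bar>z\<bar> ^ 3 \<le> (1 + \<bar>z\<bar>) ^ 3" by (intro power_mono) auto
        have "1 + \<bar>z\<bar> \<le> (1 + \<bar>z\<bar>) ^ 3" by (rule self_le_power) auto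
        then show "\<bar>z\<bar> \<le> (1 + \<bar>z\<bar>) ^ 3" by linarith
        have "1 \<le> (1 + \<bar>z\<bar>) ^ 3" by (rule one_le_power) auto
        then show "R \<le> R * (1 + \<bar>z\<bar>) ^ 3" using R by (simp add: mult_le_cancel_left1)
      qed (use M N le1 in auto)
      also have "\<dots> = (M + 1 / d + R) / sqrt N * (1 + \<bar>z\<bar>) ^ 3"
        by (simp add: algebra_simps add_divide_distrib)
      finally show ?thesis .
    qed
    have mx: "max u v \<le> max (l a) (l a + 1 + R) + (- \<kappa> * z\<^sup>2)"
    proof -
      have "M * (\<bar>p - a\<bar> * z\<^sup>2) \<le> \<kappa> * z\<^sup>2"
      proof -
        have "M * \<bar>p - a\<bar> \<le> M * r0" using pa M by (intro mult_left_mono) auto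
        then have "M * \<bar>p - a\<bar> \<le> \<kappa>" using r0 by linarith
        from mult_right_mono[OF this, of "z\<^sup>2"] show ?thesis by (simp add: mult.assoc)
      qed
      moreover have "\<bar>p - a\<bar> / d \<le> 1" using pa r0 d by (simp add: divide_le_eq)
      moreover have sz: "s / 2 * z\<^sup>2 = - \<kappa> * z\<^sup>2 - \<kappa> * z\<^sup>2" using \<kappa> by simp
      ultimately have "u \<le> (l a + 1 + R) + (- \<kappa> * z\<^sup>2)"
        using err tay labs RN unfolding cub by linarith
      moreover have "v \<le> l a + (- \<kappa> * z\<^sup>2)"
      proof -
        have "\<kappa> * z\<^sup>2 \<ge> 0" using \<kappa> by simp
        then show ?thesis unfolding v_def sz by linarith
      qed
      ultimately show ?thesis by (simp add: max_def)
    qed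
    have "\<bar>exp u - exp v\<bar> \<le> \<bar>u - v\<bar> * exp (max u v)" by (rule abs_exp_diff_le)
    also have "\<dots> \<le> ((M + 1 / d + R) / sqrt N * (1 + \<bar>z\<bar>) ^ 3)
        * exp (max (l a) (l a + 1 + R) + (- \<kappa> * z\<^sup>2))"
      using uv mx M R le1 N by (intro mult_mono) auto
    also have "\<dots> = C / sqrt N * (1 + \<bar>z\<bar>) ^ 3 * exp (- \<kappa> * z\<^sup>2)"
      unfolding C_def exp_add by simp
    finally show "\<bar>scaled_weight \<beta> h a n k - exp_nu a * exp (1/2 * A_second \<beta> h a * ((real k - real n * a) / sqrt (real n))\<^sup>2)\<bar>
       \<le> C / sqrt (real n) * (1 + \<bar>(real k - real n * a) / sqrt (real n)\<bar>) ^ 3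
          * exp (- \<kappa> * ((real k - real n * a) / sqrt (real n))\<^sup>2)"
      unfolding eu z_def[symmetric] unfolding ev N_def[symmetric] .
  qed
qed

section \<open>Gaussian Riemann sums\<close>

text \<open>The constant is 2 because the fluctuation is twice the rescaled lattice point; the bound at 0
  admits constants, whose integrals give the normalization.\<close>

definition test_function :: "(real \<Rightarrow> real) \<Rightarrow> bool" where
  "test_function \<phi> \<longleftrightarrow> \<bar>\<phi> 0\<bar> \<le> 1 \<and> (\<forall>x y. \<bar>\<phi> x - \<phi> y\<bar> \<le> 2 * \<bar>x - y\<bar>)"

lemma test_function_bound:
  assumes "test_function \<phi>"
  shows "\<bar>\<phi> x\<bar> \<le> 2 * (1 + \<bar>x\<bar>)"
proof -
  have "\<bar>\<phi> 0\<bar> \<le> 1" "\<bar>\<phi> x - \<phi> 0\<bar> \<le> 2 * \<bar>x - 0\<bar>" using assms unfolding test_function_def by blast+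
  then show ?thesis by simp
qed

lemma test_function_borel:
  assumes "test_function \<phi>"
  shows "\<phi> \<in> borel_measurable borel"
proof -
  have "2-lipschitz_on UNIV \<phi>"
    using assms by (intro lipschitz_onI) (auto simp: test_function_def dist_real_def)
  then show ?thesis
    by (intro borel_measurable_continuous_onI) (rule lipschitz_on_continuous_on)
qed

text \<open>Beyond some X the product is below 1 because it tends to 0; before X the exponential is
  at most 1 and the polynomial at most its value at |X|.\<close>

lemma poly_gauss_bounded:
  fixes \<kappa> :: real
  assumes "\<kappa> > 0"
  obtains B where "B \<ge> 0" "\<And>z. (1 + \<bar>z\<bar>) ^ m * exp (- \<kappa> * z\<^sup>2) \<le> B"
proof -
  have "((\<lambda>x. (1 + x) ^ m * exp (- \<kappa> * x\<^sup>2)) \<longlongrightarrow> 0) at_top"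
    using assms by real_asymp
  from order_tendstoD(2)[OF this, of 1] obtain X where
    X: "\<And>x. x \<ge> X \<Longrightarrow> (1 + x) ^ m * exp (- \<kappa> * x\<^sup>2) < 1"
    by (auto simp: eventually_at_top_linorder)
  show thesis
  proof (rule that[of "(1 + \<bar>X\<bar>) ^ m"])
    fix z :: real
    show "(1 + \<bar>z\<bar>) ^ m * exp (- \<kappa> * z\<^sup>2) \<le> (1 + \<bar>X\<bar>) ^ m"
    proof (cases "\<bar>z\<bar> \<ge> X")
      case True
      have "1 \<le> (1 + \<bar>X\<bar>) ^ m" by (rule one_le_power) simp
      from order_trans[OF less_imp_le[OF X[OF True]] this] show ?thesis by simp
    next
      case False
      have "(1 + \<bar>z\<bar>) ^ m * exp (- \<kappa> * z\<^sup>2) \<le> (1 + \<bar>X\<bar>) ^ m * 1"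
        using False assms by (intro mult_mono power_mono) auto
      then show ?thesis by simp
    qed
  qed simp
qed

text \<open>Two further powers of 1 + |z| are absorbed to pay for 1 + z^2. This envelope is
  integrable and changes by a bounded factor under bounded shifts, whereas a Gaussian majorant does
  not.\<close>

lemma poly_gauss_envelope:
  fixes \<kappa> :: real
  assumes "\<kappa> > 0"
  obtains B where "B \<ge> 0" "\<And>z. (1 + \<bar>z\<bar>) ^ m * exp (- \<kappa> * z\<^sup>2) \<le> B * (1 / (1 + z\<^sup>2))"
proof -
  obtain B where B: "B \<ge> 0" "\<And>z. (1 + \<bar>z\<bar>) ^ (m + 2) * exp (- \<kappa> * z\<^sup>2) \<le> B"
    using poly_gauss_bounded[OF assms, of "m + 2"] by metis
  show thesis
  proof (rule that[OF B(1)])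
    fix z :: real
    have le: "1 + z\<^sup>2 \<le> (1 + \<bar>z\<bar>)\<^sup>2" by (simp add: power2_sum)
    have pos: "0 < 1 + z\<^sup>2" by (simp add: add_pos_nonneg)
    have "((1 + \<bar>z\<bar>) ^ m * exp (- \<kappa> * z\<^sup>2)) * (1 + z\<^sup>2) \<le> ((1 + \<bar>z\<bar>) ^ m * exp (- \<kappa> * z\<^sup>2)) * (1 + \<bar>z\<bar>)\<^sup>2"
      using le by (intro mult_left_mono) auto
    also have "\<dots> \<le> B" using B(2)[of z] by (simp add: power_add power2_eq_square mult_ac)
    finally show "(1 + \<bar>z\<bar>) ^ m * exp (- \<kappa> * z\<^sup>2) \<le> B * (1 / (1 + z\<^sup>2))"
      using pos by (simp add: pos_le_divide_eq)
  qed
qed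

lemma integrable_envelope: "integrable lborel (\<lambda>x::real. 1 / (1 + x\<^sup>2))"
  using integrable_inverse_1_plus_square
  by (simp add: set_integrable_def inverse_eq_divide)

lemma integrable_test_gauss:
  assumes "test_function \<phi>" "s < 0"
  shows "integrable lborel (\<lambda>y. \<phi> y * (S * exp (1/2 * s * y\<^sup>2)))"
proof -
  obtain B where B: "B \<ge> 0" "\<And>z. (1 + \<bar>z\<bar>) ^ 1 * exp (- (-s/2) * z\<^sup>2) \<le> B * (1 / (1 + z\<^sup>2))"
    using poly_gauss_envelope[of "-s/2" 1] assms by auto
  have [measurable]: "\<phi> \<in> borel_measurable borel" by (rule test_function_borel[OF assms(1)])
  show ?thesis
  proof (rule Bochner_Integration.integrable_bound)
    show "integrable lborel (\<lambda>y. 2 * \<bar>S\<bar> * B * (1 / (1 + y\<^sup>2)))"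
      using integrable_envelope by (intro integrable_mult_right)
    show "AE y in lborel. norm (\<phi> y * (S * exp (1/2 * s * y\<^sup>2))) \<le> norm (2 * \<bar>S\<bar> * B * (1 / (1 + y\<^sup>2)))"
    proof (rule AE_I2)
      fix y :: real
      have "norm (\<phi> y * (S * exp (1/2 * s * y\<^sup>2))) = \<bar>\<phi> y\<bar> * (\<bar>S\<bar> * exp (1/2 * s * y\<^sup>2))"
        by (simp add: abs_mult)
      also have "\<dots> \<le> 2 * (1 + \<bar>y\<bar>) * (\<bar>S\<bar> * exp (1/2 * s * y\<^sup>2))"
        by (intro mult_right_mono test_function_bound assms) auto
      also have "\<dots> = 2 * \<bar>S\<bar> * ((1 + \<bar>y\<bar>) ^ 1 * exp (- (-s/2) * y\<^sup>2))" by simp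
      also have "\<dots> \<le> 2 * \<bar>S\<bar> * (B * (1 / (1 + y\<^sup>2)))" by (intro mult_left_mono B) auto
      also have "\<dots> \<le> norm (2 * \<bar>S\<bar> * B * (1 / (1 + y\<^sup>2)))" using B(1) by (simp add: abs_mult)
      finally show "norm (\<phi> y * (S * exp (1/2 * s * y\<^sup>2))) \<le> norm (2 * \<bar>S\<bar> * B * (1 / (1 + y\<^sup>2)))" .
    qed
  qed measurable
qed

text \<open>The radius is fixed on the scale of k/n, so in the rescaled coordinate the window has
  length of order sqrt n and exhausts the line.\<close>

definition window :: "real \<Rightarrow> real \<Rightarrow> nat \<Rightarrow> nat set" where
  "window a r n = {k. k \<le> n \<and> \<bar>real k / real n - a\<bar> \<le> r}"

definition rescaled :: "real \<Rightarrow> nat \<Rightarrow> nat \<Rightarrow> real" where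
  "rescaled a n k = (real k - real n * a) / sqrt (real n)"

lemma finite_window [simp]: "finite (window a r n)"
  by (rule finite_subset[of _ "{..n}"]) (auto simp: window_def)

text \<open>Since (|z|+1)^2 \<le> 2z^2 + 2, moving the envelope from a lattice point to another
  point of its cell costs a factor 3.\<close>

lemma envelope_shift:
  fixes y z :: real
  assumes "\<bar>y - z\<bar> \<le> 1"
  shows "1 / (1 + z\<^sup>2) \<le> 3 * (1 / (1 + y\<^sup>2))"
proof -
  have "y\<^sup>2 \<le> (\<bar>z\<bar> + 1)\<^sup>2" using assms by (intro abs_le_square_iff[THEN iffD1]) auto
  also have "(\<bar>z\<bar> + 1)\<^sup>2 \<le> 2 * z\<^sup>2 + 2"
    using zero_le_power2[of "\<bar>z\<bar> - 1"] by (simp add: power2_sum power2_diff)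
  finally have "y\<^sup>2 \<le> 3 * z\<^sup>2 + 2" using zero_le_power2[of z] by linarith
  then have "1 + y\<^sup>2 \<le> 3 * (1 + z\<^sup>2)" by simp
  moreover have "0 < 1 + y\<^sup>2" "0 < 1 + z\<^sup>2" by (simp_all add: add_pos_nonneg)
  ultimately show ?thesis by (simp add: field_simps)
qed

text \<open>Here z is a lattice point and y a point of its cell of width t. The error splits into
  the error of the weight at z, the variation of the Gaussian and the variation of the test
  function; each carries a factor t times the envelope at y. The last claim treats points covered by
  no cell: there 1 \<le> t |y| supplies the factor t, at the price of one power of |y|.\<close>

lemma cell_approximation:
  fixes s S \<kappa> C :: real
  assumes s: "s < 0" and S: "S \<ge> 0" and \<kappa>: "\<kappa> > 0" and C: "C \<ge> 0"
  obtains D where "D \<ge> 0"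
    "\<And>\<phi> t y z v. test_function \<phi> \<Longrightarrow> 0 < t \<Longrightarrow> t \<le> 1 \<Longrightarrow> \<bar>y - z\<bar> \<le> t \<Longrightarrow>
      \<bar>v - S * exp (1/2 * s * z\<^sup>2)\<bar> \<le> C * t * (1 + \<bar>z\<bar>) ^ 3 * exp (- \<kappa> * z\<^sup>2) \<Longrightarrow>
      \<bar>v * \<phi> z - \<phi> y * (S * exp (1/2 * s * y\<^sup>2))\<bar> \<le> D * t * (1 / (1 + y\<^sup>2))"
    "\<And>\<phi> t y. test_function \<phi> \<Longrightarrow> 0 \<le> t \<Longrightarrow> 1 \<le> t * \<bar>y\<bar> \<Longrightarrow>
      \<bar>\<phi> y * (S * exp (1/2 * s * y\<^sup>2))\<bar> \<le> D * t * (1 / (1 + y\<^sup>2))"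
proof -
  obtain B1 where B1: "B1 \<ge> 0" "\<And>z. (1 + \<bar>z\<bar>) ^ 4 * exp (- \<kappa> * z\<^sup>2) \<le> B1 * (1 / (1 + z\<^sup>2))"
    using poly_gauss_envelope[OF \<kappa>, of 4] by metis
  obtain B2 where B2: "B2 \<ge> 0" "\<And>z. (1 + \<bar>z\<bar>) ^ 2 * exp (1/2 * s * z\<^sup>2) \<le> B2 * (1 / (1 + z\<^sup>2))"
    using poly_gauss_envelope[of "-s/2" 2] s by auto
  \<comment> \<open>The three terms match \<open>T1\<close>, \<open>T2\<close>, \<open>T3\<close>: 6
    = 2 * 3 from the growth bound and the envelope shift, 10 = 6 + 4 from the Gaussian at z and at
    y, 2 from the Lipschitz constant.\<close>
  define D where "D = 6 * C * B1 + 10 * S * \<bar>s\<bar> * B2 + 2 * S * B2"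
  define E where "E y = exp (1/2 * s * y\<^sup>2)" for y
  note B2' = B2(2)[folded E_def]
  have E: "E y > 0" for y by (simp add: E_def)
  show thesis
  proof (rule that[of D])
    show "D \<ge> 0" using B1 B2 S C by (simp add: D_def)
    fix \<phi> :: "real \<Rightarrow> real" and t y :: real assume \<phi>: "test_function \<phi>"
    define W where "W = 1 / (1 + y\<^sup>2)"
    have W: "W \<ge> 0" by (simp add: W_def)
    {
      fix z v :: real
      assume t: "0 < t" "t \<le> 1" and yz: "\<bar>y - z\<bar> \<le> t"
        and v: "\<bar>v - S * exp (1/2 * s * z\<^sup>2)\<bar> \<le> C * t * (1 + \<bar>z\<bar>) ^ 3 * exp (- \<kappa> * z\<^sup>2)"
      have Wz: "1 / (1 + z\<^sup>2) \<le> 3 * W" unfolding W_def using envelope_shift yz t by simp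
      have T1: "\<bar>(v - S * E z) * \<phi> z\<bar> \<le> 6 * C * B1 * t * W"
      proof -
        have "\<bar>(v - S * E z) * \<phi> z\<bar> \<le> (C * t * (1 + \<bar>z\<bar>) ^ 3 * exp (- \<kappa> * z\<^sup>2)) * (2 * (1 + \<bar>z\<bar>))"
          unfolding abs_mult using v[folded E_def] test_function_bound[OF \<phi>, of z] C t
          by (intro mult_mono) auto
        also have "\<dots> = 2 * C * t * ((1 + \<bar>z\<bar>) ^ 4 * exp (- \<kappa> * z\<^sup>2))"
          by (simp add: eval_nat_numeral)
        also have "\<dots> \<le> 2 * C * t * (B1 * (3 * W))"
          using order_trans[OF B1(2)[of z] mult_left_mono[OF Wz B1(1)]] C t
          by (intro mult_left_mono) auto
        finally show ?thesis by (simp add: mult_ac)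
      qed
      have T2: "\<bar>(S * E z - S * E y) * \<phi> z\<bar> \<le> 10 * S * \<bar>s\<bar> * B2 * t * W"
      proof -
        have d: "\<bar>1/2 * s * z\<^sup>2 - 1/2 * s * y\<^sup>2\<bar> \<le> \<bar>s\<bar> / 2 * (t * (\<bar>z\<bar> + \<bar>y\<bar>))"
        proof -
          have "1/2 * s * z\<^sup>2 - 1/2 * s * y\<^sup>2 = s / 2 * ((z - y) * (z + y))"
            by (simp add: power2_eq_square algebra_simps)
          then have "\<bar>1/2 * s * z\<^sup>2 - 1/2 * s * y\<^sup>2\<bar> = \<bar>s\<bar> / 2 * (\<bar>z - y\<bar> * \<bar>z + y\<bar>)"
            by (simp only: abs_mult abs_divide abs_numeral)
          also have "\<dots> \<le> \<bar>s\<bar> / 2 * (t * (\<bar>z\<bar> + \<bar>y\<bar>))"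
            using yz t by (intro mult_left_mono mult_mono) auto
          finally show ?thesis .
        qed
        have "\<bar>E z - E y\<bar> \<le> (\<bar>s\<bar> / 2 * (t * (\<bar>z\<bar> + \<bar>y\<bar>))) * (E z + E y)"
        proof -
          have "exp (max (1/2 * s * z\<^sup>2) (1/2 * s * y\<^sup>2)) \<le> E z + E y"
            by (simp add: E_def max_def)
          then have "\<bar>1/2 * s * z\<^sup>2 - 1/2 * s * y\<^sup>2\<bar> * exp (max (1/2 * s * z\<^sup>2) (1/2 * s * y\<^sup>2))
              \<le> (\<bar>s\<bar> / 2 * (t * (\<bar>z\<bar> + \<bar>y\<bar>))) * (E z + E y)"
            using d t by (intro mult_mono) auto
          then show ?thesis
            unfolding E_def by (rule order_trans[OF abs_exp_diff_le])
        qed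
        then have "\<bar>(S * E z - S * E y) * \<phi> z\<bar>
          \<le> S * ((\<bar>s\<bar> / 2 * (t * (\<bar>z\<bar> + \<bar>y\<bar>))) * (E z + E y)) * (2 * (1 + \<bar>z\<bar>))"
          unfolding right_diff_distrib[symmetric] abs_mult
          using test_function_bound[OF \<phi>, of z] S t E[of z] E[of y]
          by (intro mult_mono) auto
        also have "\<dots> = S * \<bar>s\<bar> * t * ((1 + \<bar>z\<bar>) * (\<bar>z\<bar> + \<bar>y\<bar>) * E z + (1 + \<bar>z\<bar>) * (\<bar>z\<bar> + \<bar>y\<bar>) * E y)"
        proof -
          have "S * ((q / 2 * (t * w)) * (e + e')) * (2 * u) = S * q * t * (u * w * e + u * w * e')"
            for q w e e' u :: real by (simp add: field_simps)
          then show ?thesis .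
        qed
        \<comment> \<open>Each Gaussian is paired with powers of its own variable: |y-z| \<le> 1
          replaces the other one. The term at z needs the envelope shift, the term at y does
          not.\<close>
        also have "\<dots> \<le> S * \<bar>s\<bar> * t * (6 * B2 * W + 4 * B2 * W)"
        proof (intro mult_left_mono add_mono)
          have "(1 + \<bar>z\<bar>) * (\<bar>z\<bar> + \<bar>y\<bar>) * E z \<le> (1 + \<bar>z\<bar>) * (2 * (1 + \<bar>z\<bar>)) * E z"
            using yz t E[of z] by (intro mult_right_mono mult_left_mono) auto
          also have "\<dots> = 2 * ((1 + \<bar>z\<bar>) ^ 2 * E z)" by (simp add: power2_eq_square)
          also have "\<dots> \<le> 2 * (B2 * (3 * W))"
            using order_trans[OF B2'[of z] mult_left_mono[OF Wz B2(1)]] by (intro mult_left_mono) auto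
          finally show "(1 + \<bar>z\<bar>) * (\<bar>z\<bar> + \<bar>y\<bar>) * E z \<le> 6 * B2 * W" by simp
          have "(1 + \<bar>z\<bar>) * (\<bar>z\<bar> + \<bar>y\<bar>) * E y \<le> (2 * (1 + \<bar>y\<bar>)) * (2 * (1 + \<bar>y\<bar>)) * E y"
            using yz t E[of y] by (intro mult_right_mono mult_mono) auto
          also have "\<dots> = 4 * ((1 + \<bar>y\<bar>) ^ 2 * E y)"
            by (simp only: power2_eq_square mult_ac)
          also have "\<dots> \<le> 4 * (B2 * W)"
            using B2'[of y] unfolding W_def by (intro mult_left_mono) auto
          finally show "(1 + \<bar>z\<bar>) * (\<bar>z\<bar> + \<bar>y\<bar>) * E y \<le> 4 * B2 * W" by simp
        qed (use S t in auto)
        finally show ?thesis by (simp add: algebra_simps)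
      qed
      have T3: "\<bar>(\<phi> z - \<phi> y) * (S * E y)\<bar> \<le> 2 * S * B2 * t * W"
      proof -
        have "\<bar>\<phi> z - \<phi> y\<bar> \<le> 2 * \<bar>z - y\<bar>" using \<phi> unfolding test_function_def by blast
        also have "\<dots> \<le> 2 * t" using yz by (simp add: abs_minus_commute)
        finally have "\<bar>\<phi> z - \<phi> y\<bar> \<le> 2 * t" .
        then have "\<bar>(\<phi> z - \<phi> y) * (S * E y)\<bar> \<le> 2 * t * (S * E y)"
          unfolding abs_mult using S E[of y] by (intro mult_mono) auto
        also have "\<dots> \<le> 2 * t * (S * (B2 * W))"
        proof (intro mult_left_mono)
          have "1 * E y \<le> (1 + \<bar>y\<bar>) ^ 2 * E y"
            using E[of y] by (intro mult_right_mono one_le_power) auto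
          then show "E y \<le> B2 * W" using B2'[of y] unfolding W_def by linarith
        qed (use S t in auto)
        finally show ?thesis by (simp add: mult_ac)
      qed
      have "v * \<phi> z - \<phi> y * (S * E y) = (v - S * E z) * \<phi> z + (S * E z - S * E y) * \<phi> z + (\<phi> z - \<phi> y) * (S * E y)"
        by (simp add: algebra_simps)
      moreover have "D * t * W = 6 * C * B1 * t * W + 10 * S * \<bar>s\<bar> * B2 * t * W + 2 * S * B2 * t * W"
        by (simp add: D_def algebra_simps)
      ultimately show "\<bar>v * \<phi> z - \<phi> y * (S * exp (1/2 * s * y\<^sup>2))\<bar> \<le> D * t * (1 / (1 + y\<^sup>2))"
        unfolding E_def[symmetric] W_def[symmetric] using T1 T2 T3 by (simp only:)
    }
    {
      assume t: "0 \<le> t" and far: "1 \<le> t * \<bar>y\<bar>"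
      have "\<bar>\<phi> y * (S * E y)\<bar> \<le> 2 * (1 + \<bar>y\<bar>) * (S * E y)"
        unfolding abs_mult[of "\<phi> y"] using test_function_bound[OF \<phi>, of y] S E[of y]
        by (intro mult_mono) auto
      also have "\<dots> \<le> 2 * (t * (1 + \<bar>y\<bar>) * (1 + \<bar>y\<bar>)) * (S * E y)"
      proof (intro mult_right_mono mult_left_mono)
        have "1 \<le> t * (1 + \<bar>y\<bar>)" using far t by (simp add: algebra_simps)
        then show "1 + \<bar>y\<bar> \<le> t * (1 + \<bar>y\<bar>) * (1 + \<bar>y\<bar>)"
          using mult_right_mono[of 1 "t * (1 + \<bar>y\<bar>)" "1 + \<bar>y\<bar>"] by simp
      qed (use S E[of y] in auto)
      also have "\<dots> = 2 * t * S * ((1 + \<bar>y\<bar>) ^ 2 * E y)" by (simp add: power2_eq_square)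
      also have "\<dots> \<le> 2 * t * S * (B2 * W)"
        using B2'[of y] S t unfolding W_def by (intro mult_left_mono) auto
      also have "\<dots> \<le> D * t * W"
      proof -
        have "0 \<le> (6 * C * B1 + 10 * S * \<bar>s\<bar> * B2) * (t * W)"
          using B1 B2 S C t W by (intro mult_nonneg_nonneg add_nonneg_nonneg) auto
        then show ?thesis by (simp add: D_def algebra_simps)
      qed
      finally show "\<bar>\<phi> y * (S * exp (1/2 * s * y\<^sup>2))\<bar> \<le> D * t * (1 / (1 + y\<^sup>2))"
        unfolding E_def[symmetric] W_def[symmetric] .
    }
  qed
qed

text \<open>The sum divided by sqrt n is the integral of the step function F equal to the summand on
  the cell to the right of each lattice point. A pointwise bound of |F - G| by the envelope is then
  integrated. No constant involves the test function, so the quantifier over it stands inside the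
  eventuality.\<close>

lemma riemann_sum_approximation:
  fixes V :: "nat \<Rightarrow> nat \<Rightarrow> real"
  assumes a: "0 < r" "r < a" "a + r < 1" and s: "s < 0" and S: "S \<ge> 0" and \<kappa>: "\<kappa> > 0" and C: "C \<ge> 0"
    and V: "\<And>n k. 1 \<le> n \<Longrightarrow> k \<in> window a r n \<Longrightarrow>
       \<bar>V n k - S * exp (1/2 * s * (rescaled a n k)\<^sup>2)\<bar>
       \<le> C / sqrt (real n) * (1 + \<bar>rescaled a n k\<bar>) ^ 3 * exp (- \<kappa> * (rescaled a n k)\<^sup>2)"
  obtains D where "D \<ge> 0" "\<forall>\<^sub>F n in sequentially. \<forall>\<phi>. test_function \<phi> \<longrightarrow>
     \<bar>(\<Sum>k\<in>window a r n. V n k * \<phi> (rescaled a n k)) / sqrt (real n)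
       - (\<integral>y. \<phi> y * (S * exp (1/2 * s * y\<^sup>2)) \<partial>lborel)\<bar> \<le> D / sqrt (real n)"
proof -
  obtain D where D: "D \<ge> 0"
    and near: "\<And>\<phi> t y z v. test_function \<phi> \<Longrightarrow> 0 < t \<Longrightarrow> t \<le> 1 \<Longrightarrow> \<bar>y - z\<bar> \<le> t \<Longrightarrow>
      \<bar>v - S * exp (1/2 * s * z\<^sup>2)\<bar> \<le> C * t * (1 + \<bar>z\<bar>) ^ 3 * exp (- \<kappa> * z\<^sup>2) \<Longrightarrow>
      \<bar>v * \<phi> z - \<phi> y * (S * exp (1/2 * s * y\<^sup>2))\<bar> \<le> D * t * (1 / (1 + y\<^sup>2))"
    and far: "\<And>\<phi> t y. test_function \<phi> \<Longrightarrow> 0 \<le> t \<Longrightarrow> 1 \<le> t * \<bar>y\<bar> \<Longrightarrow>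
      \<bar>\<phi> y * (S * exp (1/2 * s * y\<^sup>2))\<bar> \<le> D * t * (1 / (1 + y\<^sup>2))"
    using cell_approximation[OF s S \<kappa> C] by metis
  \<comment> \<open>The summand 1 serves points inside the cells, 2/r the tail left uncovered by the
    window.\<close>
  define D' where "D' = D * (1 + 2 / r) * (\<integral>y. 1 / (1 + y\<^sup>2) \<partial>lborel)"
  show thesis
  proof (rule that[of D'])
    have "0 \<le> (\<integral>y. 1 / (1 + y\<^sup>2) \<partial>(lborel :: real measure))" by (intro integral_nonneg_AE) auto
    then show "D' \<ge> 0" using D a by (simp add: D'_def)
    have "\<forall>\<^sub>F n in sequentially. real n \<ge> max 1 (2 / r)"
      by (rule eventually_compose_filterlim[OF eventually_ge_at_top filterlim_real_sequentially])
    then show "\<forall>\<^sub>F n in sequentially. \<forall>\<phi>. test_function \<phi> \<longrightarrow>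
     \<bar>(\<Sum>k\<in>window a r n. V n k * \<phi> (rescaled a n k)) / sqrt (real n)
       - (\<integral>y. \<phi> y * (S * exp (1/2 * s * y\<^sup>2)) \<partial>lborel)\<bar> \<le> D' / sqrt (real n)"
    proof (eventually_elim, intro allI impI)
      fix n \<phi> assume n: "real n \<ge> max 1 (2 / r)" and \<phi>: "test_function \<phi>"
      have n1: "1 \<le> n" using n by simp
      define N where "N = real n"
      define t where "t = 1 / sqrt N"
      have N: "N \<ge> 1" "sqrt N \<ge> 1" "sqrt N > 0" "sqrt N * sqrt N = N" "N * r \<ge> 2"
        using n n1 a by (auto simp: N_def divide_le_eq)
      have t: "0 < t" "t \<le> 1" using N by (auto simp: t_def)
      define cell where "cell k = {rescaled a n k..<rescaled a n k + t}" for k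
      define G where "G y = \<phi> y * (S * exp (1/2 * s * y\<^sup>2))" for y
      define F where "F y = (\<Sum>k\<in>window a r n. (V n k * \<phi> (rescaled a n k)) * indicator (cell k) y)" for y
      \<comment> \<open>Cells are level sets of a floor function: at most one contributes at each y,
        and the only candidate for k is explicit.\<close>
      have cell: "y \<in> cell k \<longleftrightarrow> \<lfloor>N * a + sqrt N * y\<rfloor> = int k" for y k
      proof -
        have "rescaled a n k + t = (real k + 1 - N * a) / sqrt N"
          by (simp add: rescaled_def t_def N_def diff_divide_distrib add_divide_distrib)
        then have "y \<in> cell k \<longleftrightarrow> (real k - N * a) / sqrt N \<le> y \<and> y < (real k + 1 - N * a) / sqrt N"
          by (simp add: cell_def rescaled_def N_def)
        also have "\<dots> \<longleftrightarrow> real k \<le> N * a + sqrt N * y \<and> N * a + sqrt N * y < real k + 1"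
          using N by (simp add: pos_divide_le_eq pos_less_divide_eq algebra_simps)
        finally show ?thesis by (simp add: floor_eq_iff)
      qed
      have pointwise: "\<bar>F y - G y\<bar> \<le> D * (1 + 2 / r) * t * (1 / (1 + y\<^sup>2))" for y
      proof (cases "\<exists>k\<in>window a r n. y \<in> cell k")
        case True
        then obtain k where k: "k \<in> window a r n" "y \<in> cell k" by blast
        have "F y = (\<Sum>j\<in>window a r n. if j = k then V n j * \<phi> (rescaled a n j) else 0)"
          unfolding F_def
        proof (rule sum.cong)
          fix j show "V n j * \<phi> (rescaled a n j) * indicator (cell j) y
              = (if j = k then V n j * \<phi> (rescaled a n j) else 0)"
            using k(2) cell[of y k] cell[of y j] by (auto simp: indicator_def)
        qed simp
        then have F: "F y = V n k * \<phi> (rescaled a n k)" using k by simp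
        have "\<bar>y - rescaled a n k\<bar> \<le> t" using k(2) by (auto simp: cell_def)
        from near[OF \<phi> t this, of "V n k"] V[OF n1 k(1)]
        have "\<bar>F y - G y\<bar> \<le> D * t * (1 / (1 + y\<^sup>2))"
          unfolding F G_def by (simp add: t_def N_def)
        also have "\<dots> \<le> D * (1 + 2 / r) * t * (1 / (1 + y\<^sup>2))"
        proof (intro mult_right_mono)
          show "D \<le> D * (1 + 2 / r)" using D a by (simp add: mult_le_cancel_left1)
        qed (use t in auto)
        finally show ?thesis .
      next
        case False
        then have F: "F y = 0" by (auto simp: F_def intro!: sum.neutral)
        \<comment> \<open>Half of the radius is given away to rounding: N r \<ge> 2 makes the
          passage to the floor cost at most N r / 2, so any y closer to 0 would lie in a cell of the
          window.\<close>
        have y: "r * sqrt N / 2 \<le> \<bar>y\<bar>"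
        proof (rule ccontr)
          assume "\<not> r * sqrt N / 2 \<le> \<bar>y\<bar>"
          then have "sqrt N * \<bar>y\<bar> \<le> sqrt N * (r * sqrt N / 2)"
            using N by (intro mult_left_mono) auto
          also have "\<dots> = N * r / 2" using N by (simp add: mult_ac)
          finally have y: "\<bar>sqrt N * y\<bar> \<le> N * r / 2" using N by (simp add: abs_mult)
          define x where "x = N * a + sqrt N * y"
          have xa: "\<bar>x - N * a\<bar> \<le> N * r / 2" using y by (simp add: x_def)
          have Nr: "N * r < N * a" "N * a + N * r < N"
            using a N mult_strict_left_mono[of "a + r" 1 N] by (auto simp: distrib_left)
          have x: "0 \<le> x" "x \<le> N" using xa N Nr by linarith+
          define k where "k = nat \<lfloor>x\<rfloor>"
          have k: "int k = \<lfloor>x\<rfloor>" using x by (simp add: k_def)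
          then have rk: "real k \<le> x" "x < real k + 1" by linarith+
          have "\<bar>real k - N * a\<bar> \<le> N * r" using rk xa N by linarith
          then have "\<bar>real k / N - a\<bar> \<le> r"
          proof -
            have "real k / N - a = (real k - N * a) / N" using N by (simp add: field_simps)
            then have "\<bar>real k / N - a\<bar> = \<bar>real k - N * a\<bar> / N" using N by (simp add: abs_divide)
            then show ?thesis using \<open>\<bar>real k - N * a\<bar> \<le> N * r\<close> N by (simp add: divide_le_eq mult.commute)
          qed
          moreover have "k \<le> n" using rk x by (simp add: N_def)
          ultimately have "k \<in> window a r n" by (simp add: window_def N_def)
          moreover have "y \<in> cell k" using k cell[of y k] by (simp add: x_def)
          ultimately show False using False by blast
        qed
        \<comment> \<open>The tail estimate is applied with 2/r * t in place of the mesh t.\<close>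
        have "1 \<le> (2 / r * t) * \<bar>y\<bar>"
        proof -
          have "(2 / r * t) * (r * sqrt N / 2) \<le> (2 / r * t) * \<bar>y\<bar>"
            using y a t by (intro mult_left_mono) auto
          moreover have "(2 / r * t) * (r * sqrt N / 2) = 1" using a N by (simp add: t_def)
          ultimately show ?thesis by simp
        qed
        from far[OF \<phi> _ this] a t
        have "\<bar>F y - G y\<bar> \<le> D * (2 / r * t) * (1 / (1 + y\<^sup>2))" unfolding F G_def by simp
        also have "\<dots> = D * (2 / r) * t * (1 / (1 + y\<^sup>2))" by simp
        also have "\<dots> \<le> D * (1 + 2 / r) * t * (1 / (1 + y\<^sup>2))"
          using D t by (intro mult_right_mono mult_left_mono) auto
        finally show ?thesis .
      qed
      have intG: "integrable lborel G" unfolding G_def by (rule integrable_test_gauss[OF \<phi> s])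
      have emc: "emeasure lborel (cell k) < \<infinity>" "measure lborel (cell k) = t" for k
        using t by (auto simp: cell_def)
      have intc: "integrable lborel (\<lambda>y. c * indicator (cell k) y :: real)" for c k
        using emc[of k] by (intro integrable_mult_right) (auto simp: cell_def integrable_indicator_iff)
      have intF: "integrable lborel F" unfolding F_def by (intro Bochner_Integration.integrable_sum intc)
      have "(\<integral>y. F y \<partial>lborel) = (\<Sum>k\<in>window a r n. V n k * \<phi> (rescaled a n k) * t)"
        unfolding F_def by (subst Bochner_Integration.integral_sum[OF intc]) (simp add: emc)
      also have "\<dots> = (\<Sum>k\<in>window a r n. V n k * \<phi> (rescaled a n k)) / sqrt N"
        by (simp add: sum_divide_distrib t_def)
      finally have IF: "(\<integral>y. F y \<partial>lborel) = (\<Sum>k\<in>window a r n. V n k * \<phi> (rescaled a n k)) / sqrt N" .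
      have "\<bar>(\<integral>y. F y \<partial>lborel) - (\<integral>y. G y \<partial>lborel)\<bar> = norm (\<integral>y. F y - G y \<partial>lborel)"
        using intF intG by simp
      also have "\<dots> \<le> (\<integral>y. norm (F y - G y) \<partial>lborel)" by (rule integral_norm_bound)
      also have "\<dots> \<le> (\<integral>y. D * (1 + 2 / r) * t * (1 / (1 + y\<^sup>2)) \<partial>lborel)"
        using pointwise intF intG
        by (intro integral_mono integrable_norm Bochner_Integration.integrable_diff
            integrable_mult_right integrable_envelope) auto
      also have "\<dots> = D * (1 + 2 / r) * t * (\<integral>y. 1 / (1 + y\<^sup>2) \<partial>lborel)"
        by (rule integral_mult_right_zero)
      also have "\<dots> = D' / sqrt N" by (simp add: D'_def t_def)
      finally show "\<bar>(\<Sum>k\<in>window a r n. V n k * \<phi> (rescaled a n k)) / sqrt (real n)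
       - (\<integral>y. \<phi> y * (S * exp (1/2 * s * y\<^sup>2)) \<partial>lborel)\<bar> \<le> D' / sqrt (real n)"
        unfolding IF unfolding G_def N_def .
    qed
  qed
qed

section \<open>Laplace asymptotics, uniform over test functions\<close>

definition gauss_moment :: "real \<Rightarrow> real \<Rightarrow> real \<Rightarrow> (real \<Rightarrow> real) \<Rightarrow> real" where
  "gauss_moment \<beta> h a \<phi> = (\<integral>y. \<phi> y * (exp_nu a * exp (1/2 * A_second \<beta> h a * y\<^sup>2)) \<partial>lborel)"

text \<open>One constant D serves all test functions, as a supremum over them requires. The index
  sets are a parameter so that the same notion covers windows, for the conditional laws, and all of
  {0,...,n}, for the full law.\<close>

definition laplace_limit :: "real \<Rightarrow> real \<Rightarrow> real \<Rightarrow> (nat \<Rightarrow> nat set) \<Rightarrow> bool" where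
  "laplace_limit \<beta> h a K \<longleftrightarrow> (\<exists>D\<ge>0. \<forall>\<^sub>F n in sequentially. \<forall>\<phi>. test_function \<phi> \<longrightarrow>
     \<bar>(\<Sum>k\<in>K n. scaled_weight \<beta> h a n k * \<phi> (rescaled a n k)) / sqrt (real n) - gauss_moment \<beta> h a \<phi>\<bar>
       \<le> D / sqrt (real n))"

lemma window_laplace:
  assumes a: "0 < a" "a < 1" and crit: "A_d1 \<beta> h a = 0" and neg: "A_second \<beta> h a < 0"
  obtains r0 where "0 < r0" "r0 < a" "a + r0 < 1"
    "\<And>r. 0 < r \<Longrightarrow> r \<le> r0 \<Longrightarrow> laplace_limit \<beta> h a (window a r)"
proof -
  obtain r0 \<kappa> C where r0: "0 < r0" "r0 < a" "a + r0 < 1" and \<kappa>: "0 < \<kappa>" and C: "C \<ge> 0"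
    and loc: "\<And>n k. 1 \<le> n \<Longrightarrow> \<bar>real k / real n - a\<bar> \<le> r0 \<Longrightarrow>
       \<bar>scaled_weight \<beta> h a n k - exp_nu a * exp (1/2 * A_second \<beta> h a * ((real k - real n * a) / sqrt (real n))\<^sup>2)\<bar>
       \<le> C / sqrt (real n) * (1 + \<bar>(real k - real n * a) / sqrt (real n)\<bar>) ^ 3
          * exp (- \<kappa> * ((real k - real n * a) / sqrt (real n))\<^sup>2)"
    using scaled_weight_local[OF assms] by metis
  have nu: "exp_nu a \<ge> 0" by (simp add: exp_nu_def)
  show thesis
  proof (rule that[OF r0])
    fix r assume r: "0 < r" "r \<le> r0"
    have "r < a" "a + r < 1" using r r0 by linarith+
    moreover have "\<bar>scaled_weight \<beta> h a n k - exp_nu a * exp (1/2 * A_second \<beta> h a * (rescaled a n k)\<^sup>2)\<bar>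
       \<le> C / sqrt (real n) * (1 + \<bar>rescaled a n k\<bar>) ^ 3 * exp (- \<kappa> * (rescaled a n k)\<^sup>2)"
      if "1 \<le> n" "k \<in> window a r n" for n k
      using loc[OF that(1), of k] that(2) r unfolding window_def rescaled_def by simp
    ultimately show "laplace_limit \<beta> h a (window a r)"
      using riemann_sum_approximation[OF r(1) _ _ neg nu \<kappa> C, of a "scaled_weight \<beta> h a"]
      unfolding laplace_limit_def gauss_moment_def by blast
  qed
qed

section \<open>Reduction to the number of plus spins\<close>

definition plus_count :: "nat \<Rightarrow> (nat \<Rightarrow> real) \<Rightarrow> nat" where
  "plus_count n \<omega> = card {i \<in> {..<n}. \<omega> i = 1}"

lemma finite_configs [simp]: "finite (configs n)"
  unfolding configs_def by (intro finite_PiE) auto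

lemma bij_betw_configs: "bij_betw (\<lambda>\<omega>. {i \<in> {..<n}. \<omega> i = 1}) (configs n) (Pow {..<n})"
proof (rule bij_betwI[where g = "\<lambda>A. restrict (\<lambda>i. if i \<in> A then 1 else - 1) {..<n}"])
  show "restrict (\<lambda>i. if i \<in> {i \<in> {..<n}. \<omega> i = 1} then 1 else - 1) {..<n} = \<omega>"
    if "\<omega> \<in> configs n" for \<omega>
    using that by (fastforce simp: configs_def PiE_def Pi_def extensional_def fun_eq_iff)
  show "{i \<in> {..<n}. (\<lambda>i\<in>{..<n}. if i \<in> A then 1 else - 1) i = (1 :: real)} = A" if "A \<in> Pow {..<n}" for A
    using that by (auto split: if_splits)
qed (auto simp: configs_def)

lemma card_subset_lessThan: "A \<subseteq> {..<n} \<Longrightarrow> card A \<le> n"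
  using card_mono[OF finite_lessThan, of A n] by simp

text \<open>Configurations correspond to their sets of plus sites, and these subsets are grouped by
  cardinality.\<close>

lemma sum_configs:
  fixes G :: "nat \<Rightarrow> real"
  shows "(\<Sum>\<omega>\<in>configs n. G (plus_count n \<omega>)) = (\<Sum>k\<le>n. real (n choose k) * G k)"
proof -
  have "(\<Sum>\<omega>\<in>configs n. G (plus_count n \<omega>)) = (\<Sum>A\<in>Pow {..<n}. G (card A))"
    unfolding plus_count_def by (rule sum.reindex_bij_betw[OF bij_betw_configs])
  also have "\<dots> = (\<Sum>k\<le>n. \<Sum>A\<in>{A \<in> Pow {..<n}. card A = k}. G (card A))"
    by (rule sum.group[symmetric]) (auto intro: card_subset_lessThan)
  also have "\<dots> = (\<Sum>k\<le>n. real (n choose k) * G k)"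
  proof (rule sum.cong)
    fix k
    have "card {A \<in> Pow {..<n}. card A = k} = n choose k"
      using n_subsets[of "{..<n}" k] by simp
    then show "(\<Sum>A\<in>{A \<in> Pow {..<n}. card A = k}. G (card A)) = real (n choose k) * G k"
      by simp
  qed simp
  finally show ?thesis .
qed

lemma plus_count_le: "plus_count n \<omega> \<le> n"
  unfolding plus_count_def by (rule card_subset_lessThan) auto

lemma magnetization_eq:
  assumes "\<omega> \<in> configs n"
  shows "magnetization n \<omega> = 2 * real (plus_count n \<omega>) - real n"
proof -
  have "\<omega> i = 2 * (if \<omega> i = 1 then 1 else 0) - 1" if "i < n" for i
    using assms that by (fastforce simp: configs_def PiE_def Pi_def)
  then have "magnetization n \<omega> = (\<Sum>i<n. 2 * (if \<omega> i = 1 then 1 else 0) - 1)"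
    unfolding magnetization_def by (intro sum.cong) auto
  also have "\<dots> = 2 * (\<Sum>i<n. if \<omega> i = 1 then 1 else 0) - real n"
    by (simp add: sum_subtractf sum_distrib_left)
  also have "(\<Sum>i<n. if \<omega> i = 1 then 1 else (0::real)) = real (plus_count n \<omega>)"
    unfolding plus_count_def by (subst sum.If_cases) (auto simp: Int_def)
  finally show ?thesis .
qed

lemma partition_fun_eq: "partition_fun \<beta> h n = (\<Sum>k\<le>n. weight \<beta> h n k)"
  using sum_configs[of "\<lambda>k. exp (real n * f_cubic \<beta> h (real k / real n))" n]
  by (simp add: partition_fun_def plus_fraction_def plus_count_def weight_def)

lemma partition_fun_pos: "partition_fun \<beta> h n > 0"
  unfolding partition_fun_eq by (intro sum_pos) (auto simp: weight_def)

lemma space_gibbs [simp]: "space (gibbs \<beta> h n) = configs n"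
  and sets_gibbs [simp]: "sets (gibbs \<beta> h n) = Pow (configs n)"
  by (simp_all add: gibbs_def space_point_measure sets_point_measure)

lemma gibbs_expectation_weight:
  fixes G :: "nat \<Rightarrow> real"
  shows "(\<integral>\<omega>. G (plus_count n \<omega>) \<partial>gibbs \<beta> h n) = (\<Sum>k\<le>n. weight \<beta> h n k * G k) / partition_fun \<beta> h n"
proof -
  have "(\<integral>\<omega>. G (plus_count n \<omega>) \<partial>gibbs \<beta> h n)
    = (\<Sum>\<omega>\<in>configs n. exp (real n * f_cubic \<beta> h (plus_fraction n \<omega>)) / partition_fun \<beta> h n * G (plus_count n \<omega>))"
    unfolding gibbs_def using partition_fun_pos[of \<beta> h n]
    by (subst lebesgue_integral_point_measure_finite) (auto intro: divide_nonneg_pos)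
  also have "\<dots> = (\<Sum>\<omega>\<in>configs n. (\<lambda>k. exp (real n * f_cubic \<beta> h (real k / real n)) / partition_fun \<beta> h n * G k) (plus_count n \<omega>))"
    by (simp add: plus_fraction_def plus_count_def)
  also have "\<dots> = (\<Sum>k\<le>n. weight \<beta> h n k * G k) / partition_fun \<beta> h n"
    unfolding sum_configs[of "\<lambda>k. exp (real n * f_cubic \<beta> h (real k / real n)) / partition_fun \<beta> h n * G k"]
    by (simp add: weight_def sum_divide_distrib mult_ac)
  finally show ?thesis .
qed

text \<open>Scaled and plain weights differ by a positive factor independent of k, which cancels in
  the quotient; hence a may be any point.\<close>

lemma gibbs_expectation:
  fixes G :: "nat \<Rightarrow> real"
  assumes "n \<ge> 1"
  shows "(\<integral>\<omega>. G (plus_count n \<omega>) \<partial>gibbs \<beta> h n)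
    = (\<Sum>k\<le>n. scaled_weight \<beta> h a n k * G k) / (\<Sum>k\<le>n. scaled_weight \<beta> h a n k)"
  unfolding gibbs_expectation_weight partition_fun_eq scaled_weight_def
  using assms by (simp add: mult.assoc sum_distrib_left[symmetric])

lemma gibbs_measure:
  assumes "n \<ge> 1" and "\<And>\<omega>. \<omega> \<in> configs n \<Longrightarrow> \<omega> \<in> E \<longleftrightarrow> plus_count n \<omega> \<in> K" and "E \<subseteq> configs n"
  shows "measure (gibbs \<beta> h n) E
    = (\<Sum>k\<in>{k. k \<le> n \<and> k \<in> K}. scaled_weight \<beta> h a n k) / (\<Sum>k\<le>n. scaled_weight \<beta> h a n k)"
proof -
  have "measure (gibbs \<beta> h n) E = (\<integral>\<omega>. indicator E \<omega> \<partial>gibbs \<beta> h n)"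
    using assms(3) by (simp add: Int_absorb2)
  also have "\<dots> = (\<integral>\<omega>. indicator K (plus_count n \<omega>) \<partial>gibbs \<beta> h n)"
    using assms(2) by (intro Bochner_Integration.integral_cong) (auto simp: indicator_def)
  also have "\<dots> = (\<Sum>k\<le>n. scaled_weight \<beta> h a n k * indicator K k) / (\<Sum>k\<le>n. scaled_weight \<beta> h a n k)"
    by (rule gibbs_expectation[OF assms(1)])
  also have "(\<Sum>k\<le>n. scaled_weight \<beta> h a n k * indicator K k) = (\<Sum>k\<in>{k. k \<le> n \<and> k \<in> K}. scaled_weight \<beta> h a n k)"
    by (rule sum.mono_neutral_cong_right) (auto simp: indicator_def)
  finally show ?thesis .
qed

lemma prob_space_gibbs: "prob_space (gibbs \<beta> h n)"
proof -
  have "(\<Sum>\<omega>\<in>configs n. exp (real n * f_cubic \<beta> h (plus_fraction n \<omega>)) / partition_fun \<beta> h n) = 1"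
    using partition_fun_pos[of \<beta> h n] by (simp add: sum_divide_distrib[symmetric] partition_fun_def)
  then show ?thesis
    unfolding gibbs_def using partition_fun_pos[of \<beta> h n]
    by (intro prob_space_point_measure) (auto simp: sum_ennreal intro: divide_nonneg_pos)
qed

lemma measurable_gibbs [measurable]: "f \<in> measurable (gibbs \<beta> h n) borel"
  by (simp add: gibbs_def)

lemma fluctuation_eq:
  assumes "\<omega> \<in> configs n" "n \<ge> 1"
  shows "fluctuation n (2 * a - 1) \<omega> = 2 * rescaled a n (plus_count n \<omega>)"
  using magnetization_eq[OF assms(1)] assms(2)
  by (simp add: fluctuation_def rescaled_def field_simps)

lemma lipschitz_borel:
  fixes f :: "real \<Rightarrow> real"
  assumes "1-lipschitz_on UNIV f"
  shows "f \<in> borel_measurable borel"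
  using assms by (intro borel_measurable_continuous_onI) (rule lipschitz_on_continuous_on)

lemma fluctuation_law_expectation:
  fixes f :: "real \<Rightarrow> real"
  assumes "n \<ge> 1" and [measurable]: "f \<in> borel_measurable borel"
  shows "(\<integral>x. f x \<partial>fluctuation_law \<beta> h n (2 * a - 1))
    = (\<Sum>k\<le>n. scaled_weight \<beta> h a n k * f (2 * rescaled a n k)) / (\<Sum>k\<le>n. scaled_weight \<beta> h a n k)"
proof -
  have "(\<integral>x. f x \<partial>fluctuation_law \<beta> h n (2 * a - 1)) = (\<integral>\<omega>. f (fluctuation n (2 * a - 1) \<omega>) \<partial>gibbs \<beta> h n)"
    unfolding fluctuation_law_def by (rule integral_distr) measurable
  also have "\<dots> = (\<integral>\<omega>. f (2 * rescaled a n (plus_count n \<omega>)) \<partial>gibbs \<beta> h n)"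
    by (rule Bochner_Integration.integral_cong) (simp_all add: fluctuation_eq[OF _ assms(1)])
  also have "\<dots> = (\<Sum>k\<le>n. scaled_weight \<beta> h a n k * f (2 * rescaled a n k)) / (\<Sum>k\<le>n. scaled_weight \<beta> h a n k)"
    by (rule gibbs_expectation[OF assms(1)])
  finally show ?thesis .
qed

text \<open>The conditional measure is rewritten as a real density, the indicator of E over the mass
  of E.\<close>

lemma integral_uniform_measure:
  fixes f :: "'a \<Rightarrow> real"
  assumes "finite_measure M" "E \<in> sets M" "measure M E \<noteq> 0" "f \<in> borel_measurable M"
  shows "(\<integral>x. f x \<partial>uniform_measure M E) = (\<integral>x. indicator E x * f x \<partial>M) / measure M E"
proof -
  interpret finite_measure M by fact
  have pos: "measure M E > 0" using assms(3) by (simp add: less_le)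
  have "1 / ennreal (measure M E) = ennreal (1 / measure M E)"
    using divide_ennreal[of 1 "measure M E"] pos by simp
  then have "uniform_measure M E = density M (\<lambda>x. ennreal (indicator E x / measure M E))"
    unfolding uniform_measure_def using assms(2)
    by (intro density_cong) (auto simp: emeasure_eq_measure indicator_def)
  then have "(\<integral>x. f x \<partial>uniform_measure M E) = (\<integral>x. indicator E x / measure M E * f x \<partial>M)"
    using pos assms(2,4) by (simp add: integral_density)
  then show ?thesis by simp
qed

text \<open>Since M/n = 2k/n - 1, a distance \<delta> for the magnetization is a distance \<delta>/2
  for the fraction of plus spins. This is the origin of every \<delta>/2 below.\<close>

lemma window_event:
  assumes "\<omega> \<in> configs n" "n \<ge> 1"
  shows "\<bar>magnetization n \<omega> / real n - (2 * a - 1)\<bar> \<le> \<delta> \<longleftrightarrow> plus_count n \<omega> \<in> window a (\<delta> / 2) n"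
proof -
  have "magnetization n \<omega> / real n - (2 * a - 1) = 2 * (real (plus_count n \<omega>) / real n - a)"
    using magnetization_eq[OF assms(1)] assms(2) by (simp add: field_simps)
  then have "\<bar>magnetization n \<omega> / real n - (2 * a - 1)\<bar> = 2 * \<bar>real (plus_count n \<omega>) / real n - a\<bar>"
    by (simp only: abs_mult abs_numeral)
  then show ?thesis using plus_count_le[of n \<omega>] by (simp add: window_def mult.commute)
qed

lemma window_eq_Int: "{k. k \<le> n \<and> k \<in> window a r n} = window a r n"
  by (auto simp: window_def)

lemma cond_fluctuation_law_expectation:
  fixes f :: "real \<Rightarrow> real"
  assumes n: "n \<ge> 1" and [measurable]: "f \<in> borel_measurable borel"
    and ne: "(\<Sum>k\<in>window a (\<delta>/2) n. scaled_weight \<beta> h a n k) \<noteq> 0"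
  shows "(\<integral>x. f x \<partial>cond_fluctuation_law \<beta> h n (2 * a - 1) \<delta>)
    = (\<Sum>k\<in>window a (\<delta>/2) n. scaled_weight \<beta> h a n k * f (2 * rescaled a n k))
      / (\<Sum>k\<in>window a (\<delta>/2) n. scaled_weight \<beta> h a n k)"
proof -
  interpret prob_space "gibbs \<beta> h n" by (rule prob_space_gibbs)
  define E where "E = {\<omega> \<in> space (gibbs \<beta> h n). \<bar>magnetization n \<omega> / real n - (2 * a - 1)\<bar> \<le> \<delta>}"
  define Z where "Z = (\<Sum>k\<le>n. scaled_weight \<beta> h a n k)"
  have Z: "Z > 0" unfolding Z_def using n by (intro sum_pos scaled_weight_pos) auto
  have E: "E \<in> sets (gibbs \<beta> h n)" by (auto simp: E_def)
  have mE: "measure (gibbs \<beta> h n) E = (\<Sum>k\<in>window a (\<delta>/2) n. scaled_weight \<beta> h a n k) / Z"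
    unfolding Z_def
    by (subst gibbs_measure[where K = "window a (\<delta>/2) n" and a = a])
      (use n window_event[OF _ n] in \<open>auto simp: E_def window_eq_Int\<close>)
  have "(\<integral>x. f x \<partial>cond_fluctuation_law \<beta> h n (2 * a - 1) \<delta>)
    = (\<integral>\<omega>. f (fluctuation n (2 * a - 1) \<omega>) \<partial>uniform_measure (gibbs \<beta> h n) E)"
    unfolding cond_fluctuation_law_def E_def[symmetric]
    by (rule integral_distr) (simp add: measurable_def, measurable)
  also have "\<dots> = (\<integral>\<omega>. indicator E \<omega> * f (fluctuation n (2 * a - 1) \<omega>) \<partial>gibbs \<beta> h n) / measure (gibbs \<beta> h n) E"
    using ne Z mE by (intro integral_uniform_measure E finite_measure_axioms) auto
  also have "(\<integral>\<omega>. indicator E \<omega> * f (fluctuation n (2 * a - 1) \<omega>) \<partial>gibbs \<beta> h n)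
    = (\<integral>\<omega>. indicator (window a (\<delta>/2) n) (plus_count n \<omega>) * f (2 * rescaled a n (plus_count n \<omega>)) \<partial>gibbs \<beta> h n)"
    using window_event[OF _ n]
    by (intro Bochner_Integration.integral_cong) (simp_all add: fluctuation_eq[OF _ n] E_def indicator_def)
  also have "\<dots> = (\<Sum>k\<le>n. scaled_weight \<beta> h a n k * (indicator (window a (\<delta>/2) n) k * f (2 * rescaled a n k))) / Z"
    unfolding Z_def by (rule gibbs_expectation[OF n])
  also have "(\<Sum>k\<le>n. scaled_weight \<beta> h a n k * (indicator (window a (\<delta>/2) n) k * f (2 * rescaled a n k)))
    = (\<Sum>k\<in>window a (\<delta>/2) n. scaled_weight \<beta> h a n k * f (2 * rescaled a n k))"
    by (rule sum.mono_neutral_cong_right) (auto simp: indicator_def window_def)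
  finally show ?thesis using Z by (simp add: mE)
qed

lemma wasserstein_leI:
  assumes "\<And>f. 1-lipschitz_on UNIV f \<Longrightarrow> \<bar>(\<integral>x. f x \<partial>P) - (\<integral>x. f x \<partial>Q)\<bar> \<le> c"
  shows "wasserstein P Q \<le> ennreal c"
  unfolding wasserstein_def using assms by (intro SUP_least ennreal_leI) auto

section \<open>Laplace asymptotics\<close>

lemma maximizers_value_eq:
  "a \<in> maximizers \<beta> h \<Longrightarrow> b \<in> maximizers \<beta> h \<Longrightarrow> A_fun \<beta> h a = A_fun \<beta> h b"
  unfolding maximizers_def by (auto intro: antisym)

lemma scaled_weight_cong_maximizers:
  "a \<in> maximizers \<beta> h \<Longrightarrow> b \<in> maximizers \<beta> h \<Longrightarrow> scaled_weight \<beta> h a = scaled_weight \<beta> h b"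
  unfolding scaled_weight_def fun_eq_iff by (simp add: maximizers_value_eq[of a \<beta> h b])

text \<open>The points of [0,1] at distance at least r from all maximizers form a compact set. A
  attains its supremum there, at a point that is not a maximizer, so the supremum is strictly below
  the global maximum.\<close>

lemma maximizer_gap:
  assumes m: "m \<in> maximizers \<beta> h" and r: "r > 0"
  obtains \<eta> where "\<eta> > 0"
    "\<And>x. x \<in> {0..1} \<Longrightarrow> (\<And>a. a \<in> maximizers \<beta> h \<Longrightarrow> r \<le> \<bar>x - a\<bar>) \<Longrightarrow> A_fun \<beta> h x \<le> A_fun \<beta> h m - \<eta>"
proof -
  define K where "K = {0..1} \<inter> (\<Inter>a\<in>maximizers \<beta> h. {x. r \<le> \<bar>x - a\<bar>})"
  have "closed (\<Inter>a\<in>maximizers \<beta> h. {x. r \<le> \<bar>x - a\<bar>})"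
    by (intro closed_INT ballI closed_Collect_le continuous_intros)
  then have K: "compact K" unfolding K_def by (intro compact_Int_closed) auto
  show thesis
  proof (cases "K = {}")
    case True
    \<comment> \<open>With no far points the claim is vacuous and any positive gap serves.\<close>
    then show thesis by (intro that[of 1]) (auto simp: K_def)
  next
    case False
    have "continuous_on K (A_fun \<beta> h)"
      by (rule continuous_on_subset[OF continuous_on_A_fun]) (auto simp: K_def)
    from continuous_attains_sup[OF K False this] obtain x0
      where x0: "x0 \<in> K" "\<And>x. x \<in> K \<Longrightarrow> A_fun \<beta> h x \<le> A_fun \<beta> h x0" by blast
    have "x0 \<in> {0..1}" "x0 \<notin> maximizers \<beta> h" using x0(1) r by (auto simp: K_def)
    then obtain b where "b \<in> {0..1}" "A_fun \<beta> h x0 < A_fun \<beta> h b"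
      unfolding maximizers_def by (auto simp: not_le)
    moreover from this m have "A_fun \<beta> h b \<le> A_fun \<beta> h m" unfolding maximizers_def by blast
    ultimately have "A_fun \<beta> h x0 < A_fun \<beta> h m" by linarith
    then show thesis using x0(2)
      by (intro that[of "A_fun \<beta> h m - A_fun \<beta> h x0"]) (auto simp: K_def)
  qed
qed

text \<open>The strict inequality complements the closed \<open>window\<close>, so the windows of
  radius r around all maximizers together with this set cover {0,...,n}.\<close>

definition far_set :: "real \<Rightarrow> real \<Rightarrow> real \<Rightarrow> nat \<Rightarrow> nat set" where
  "far_set \<beta> h r n = {k. k \<le> n \<and> (\<forall>a\<in>maximizers \<beta> h. r < \<bar>real k / real n - a\<bar>)}"

lemma finite_far_set [simp]: "finite (far_set \<beta> h r n)"
  by (rule finite_subset[of _ "{..n}"]) (auto simp: far_set_def)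

text \<open>Each far weight is estimated by the entropy bound and the gap \<eta>, and there are at
  most n + 1 of them. Stirling's formula would fail near the edges; the polynomial factors lost here
  are harmless.\<close>

lemma far_set_sum_bound:
  assumes m: "m \<in> maximizers \<beta> h" and r: "r > 0"
  obtains \<eta> where "\<eta> > 0" "\<And>n. n \<ge> 1 \<Longrightarrow> (\<Sum>k\<in>far_set \<beta> h r n. scaled_weight \<beta> h m n k)
     \<le> (real n + 1) * (exp stirling_const * sqrt (real n) * exp (- \<eta> * real n))"
proof -
  obtain \<eta> where \<eta>: "\<eta> > 0" and gap: "\<And>x. x \<in> {0..1} \<Longrightarrow>
     (\<And>a. a \<in> maximizers \<beta> h \<Longrightarrow> r \<le> \<bar>x - a\<bar>) \<Longrightarrow> A_fun \<beta> h x \<le> A_fun \<beta> h m - \<eta>"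
    using maximizer_gap[OF m r] by metis
  show thesis
  proof (rule that[OF \<eta>])
    fix n :: nat assume n: "n \<ge> 1"
    define c where "c = exp stirling_const * sqrt (real n)"
    have c: "c \<ge> 0" by (simp add: c_def)
    have le: "scaled_weight \<beta> h m n k \<le> c * exp (- \<eta> * real n)" if k: "k \<in> far_set \<beta> h r n" for k
    proof -
      define x where "x = real k / real n"
      have kn: "k \<le> n" using k by (simp add: far_set_def)
      have x: "x \<in> {0..1}" using kn n by (simp add: x_def)
      have "A_fun \<beta> h x \<le> A_fun \<beta> h m - \<eta>"
        using k by (intro gap[OF x]) (auto simp: far_set_def x_def intro: less_imp_le)
      then have ex: "real n * A_fun \<beta> h x \<le> real n * (A_fun \<beta> h m - \<eta>)" by (intro mult_left_mono) auto
      have "weight \<beta> h n k \<le> exp (real n * entropy_fun x) * exp (real n * f_cubic \<beta> h x)"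
        unfolding weight_def x_def using kn by (intro mult_right_mono binomial_le_exp_entropy) auto
      also have "\<dots> = exp (real n * A_fun \<beta> h x)"
        by (simp add: exp_add[symmetric] A_fun_def algebra_simps)
      also have "\<dots> \<le> exp (real n * (A_fun \<beta> h m - \<eta>))" using ex by simp
      finally have "scaled_weight \<beta> h m n k \<le> c * exp (- real n * A_fun \<beta> h m) * exp (real n * (A_fun \<beta> h m - \<eta>))"
        unfolding scaled_weight_def c_def[symmetric] using c by (intro mult_left_mono) auto
      also have "\<dots> = c * exp (- \<eta> * real n)"
        by (simp add: mult.assoc exp_add[symmetric] algebra_simps)
      finally show ?thesis .
    qed
    have "card (far_set \<beta> h r n) \<le> card {..n}"
      by (rule card_mono) (auto simp: far_set_def)
    then have "real (card (far_set \<beta> h r n)) \<le> real n + 1" by simp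
    then have "real (card (far_set \<beta> h r n)) * (c * exp (- \<eta> * real n)) \<le> (real n + 1) * (c * exp (- \<eta> * real n))"
      using c by (intro mult_right_mono) auto
    with sum_bounded_above[of "far_set \<beta> h r n", OF le]
    have "(\<Sum>k\<in>far_set \<beta> h r n. scaled_weight \<beta> h m n k) \<le> (real n + 1) * (c * exp (- \<eta> * real n))"
      by (rule order_trans)
    then show "(\<Sum>k\<in>far_set \<beta> h r n. scaled_weight \<beta> h m n k)
     \<le> (real n + 1) * (exp stirling_const * sqrt (real n) * exp (- \<eta> * real n))"
      unfolding c_def .
  qed
qed

section \<open>Gaussian normalization and quotient estimates\<close>

lemma normal_expectation:
  assumes s: "s < 0" and f: "f \<in> borel_measurable borel"
  shows "(\<integral>y. exp (1/2 * s * y\<^sup>2) \<partial>lborel) > 0"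
    and "(\<integral>x. f x \<partial>centered_normal (4 / \<bar>s\<bar>))
      = (\<integral>y. f (2 * y) * exp (1/2 * s * y\<^sup>2) \<partial>lborel) / (\<integral>y. exp (1/2 * s * y\<^sup>2) \<partial>lborel)"
proof -
  define \<sigma> where "\<sigma> = sqrt (4 / \<bar>s\<bar>)"
  have \<sigma>: "\<sigma> > 0" "\<sigma>\<^sup>2 = 4 / \<bar>s\<bar>" using s by (auto simp: \<sigma>_def)
  define c where "c = 2 / sqrt (2 * pi * \<sigma>\<^sup>2)"
  have c: "c > 0" using \<sigma>(1) by (simp add: c_def)
  \<comment> \<open>The substitution x = 2y, with Jacobian 2, turns variance 4/|s| into the exponent
    s y^2 / 2. It reflects that fluctuations of M are twice those of the number of plus
    spins.\<close>
  have dens: "2 * normal_density 0 \<sigma> (2 * y) = c * exp (1/2 * s * y\<^sup>2)" for y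
  proof -
    have "- (2 * y - 0)\<^sup>2 / (2 * \<sigma>\<^sup>2) = 1/2 * s * y\<^sup>2"
      unfolding \<sigma>(2) using s by (simp add: power_mult_distrib field_simps)
    then show ?thesis unfolding normal_density_def c_def by (simp only:)
  qed
  have scale: "(\<integral>x. normal_density 0 \<sigma> x * g x \<partial>lborel) = c * (\<integral>y. g (2 * y) * exp (1/2 * s * y\<^sup>2) \<partial>lborel)" for g :: "real \<Rightarrow> real"
  proof -
    have "(\<integral>x. normal_density 0 \<sigma> x * g x \<partial>lborel)
      = (\<integral>y. 2 * normal_density 0 \<sigma> (2 * y) * g (2 * y) \<partial>lborel)"
      by (subst lborel_integral_real_affine[where c = 2 and t = 0]) (simp_all add: mult.assoc)
    also have "\<dots> = (\<integral>y. c * (g (2 * y) * exp (1/2 * s * y\<^sup>2)) \<partial>lborel)"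
    proof (intro Bochner_Integration.integral_cong refl)
      show "2 * normal_density 0 \<sigma> (2 * y) * g (2 * y) = c * (g (2 * y) * exp (1/2 * s * y\<^sup>2))" for y
        unfolding dens by (simp only: mult_ac)
    qed
    finally show ?thesis by simp
  qed
  \<comment> \<open>The total mass 1 of the normal law identifies the Gaussian integral as 1/c,
    which also gives its positivity.\<close>
  have one: "c * (\<integral>y. exp (1/2 * s * y\<^sup>2) \<partial>lborel) = 1"
    using scale[of "\<lambda>_. 1"] integral_normal_density[OF \<sigma>(1), of 0] by simp
  then show pos: "(\<integral>y. exp (1/2 * s * y\<^sup>2) \<partial>lborel) > 0"
    using c by (metis zero_less_mult_pos zero_less_one)
  have "(\<integral>x. f x \<partial>centered_normal (4 / \<bar>s\<bar>)) = (\<integral>x. normal_density 0 \<sigma> x * f x \<partial>lborel)"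
    unfolding centered_normal_def \<sigma>_def[symmetric] using f
    by (subst integral_density) (auto simp: normal_density_nonneg)
  also have "\<dots> = c * (\<integral>y. f (2 * y) * exp (1/2 * s * y\<^sup>2) \<partial>lborel)" by (rule scale)
  finally show "(\<integral>x. f x \<partial>centered_normal (4 / \<bar>s\<bar>))
      = (\<integral>y. f (2 * y) * exp (1/2 * s * y\<^sup>2) \<partial>lborel) / (\<integral>y. exp (1/2 * s * y\<^sup>2) \<partial>lborel)"
    using one pos by (simp add: field_simps)
qed

lemma test_function_one: "test_function (\<lambda>_. 1)"
  by (simp add: test_function_def)

lemma test_function_abs: "test_function (\<lambda>y. 1 + \<bar>y\<bar>)"
proof -
  have "\<bar>\<bar>x\<bar> - \<bar>y\<bar>\<bar> \<le> 2 * \<bar>x - y\<bar>" for x y :: real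
    by (rule order_trans[OF abs_triangle_ineq3]) simp
  then show ?thesis by (simp add: test_function_def)
qed

lemma gauss_moment_one: "gauss_moment \<beta> h a (\<lambda>_. 1) = exp_nu a * q_weight \<beta> h a"
  by (simp add: gauss_moment_def q_weight_def)

lemma gauss_moment_one_pos:
  assumes "0 < a" "a < 1" "A_second \<beta> h a < 0"
  shows "gauss_moment \<beta> h a (\<lambda>_. 1) > 0"
  unfolding gauss_moment_one q_weight_def exp_nu_eq[OF assms(1,2)]
  using normal_expectation(1)[OF assms(3), of "\<lambda>_. 0"] by simp

text \<open>A bound common to all test functions; it keeps the constant of the quotient estimate
  uniform.\<close>

lemma gauss_moment_bound:
  assumes "test_function \<phi>" "A_second \<beta> h a < 0"
  shows "\<bar>gauss_moment \<beta> h a \<phi>\<bar> \<le> 2 * gauss_moment \<beta> h a (\<lambda>y. 1 + \<bar>y\<bar>)"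
proof -
  define w where "w y = exp_nu a * exp (1/2 * A_second \<beta> h a * y\<^sup>2)" for y
  have w: "w y \<ge> 0" for y by (simp add: w_def exp_nu_def)
  have "\<bar>gauss_moment \<beta> h a \<phi>\<bar> \<le> (\<integral>y. norm (\<phi> y * w y) \<partial>lborel)"
    unfolding gauss_moment_def w_def[symmetric]
    using integral_norm_bound[of lborel "\<lambda>y. \<phi> y * w y"] by simp
  also have "\<dots> \<le> (\<integral>y. 2 * ((1 + \<bar>y\<bar>) * w y) \<partial>lborel)"
  proof (rule integral_mono)
    show "integrable lborel (\<lambda>y. norm (\<phi> y * w y))" unfolding w_def
      by (intro integrable_norm integrable_test_gauss assms)
    show "integrable lborel (\<lambda>y. 2 * ((1 + \<bar>y\<bar>) * w y))" unfolding w_def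
      by (intro integrable_mult_right integrable_test_gauss assms test_function_abs)
    show "norm (\<phi> y * w y) \<le> 2 * ((1 + \<bar>y\<bar>) * w y)" for y
    proof -
      have "norm (\<phi> y * w y) = \<bar>\<phi> y\<bar> * w y" using w[of y] by (simp add: abs_mult)
      also have "\<dots> \<le> 2 * (1 + \<bar>y\<bar>) * w y"
        by (intro mult_right_mono test_function_bound assms w)
      finally show ?thesis by (simp only: mult.assoc)
    qed
  qed
  also have "\<dots> = 2 * gauss_moment \<beta> h a (\<lambda>y. 1 + \<bar>y\<bar>)" by (simp add: gauss_moment_def w_def)
  finally show ?thesis .
qed

lemma tendsto_const_over_sqrt: "(\<lambda>n. D / sqrt (real n)) \<longlonglongrightarrow> 0"
  by real_asymp

lemma laplace_limit_total:
  assumes "laplace_limit \<beta> h a K"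
  shows "(\<lambda>n. (\<Sum>k\<in>K n. scaled_weight \<beta> h a n k) / sqrt (real n)) \<longlonglongrightarrow> exp_nu a * q_weight \<beta> h a"
proof -
  from assms obtain D where "\<forall>\<^sub>F n in sequentially. \<forall>\<phi>. test_function \<phi> \<longrightarrow>
     \<bar>(\<Sum>k\<in>K n. scaled_weight \<beta> h a n k * \<phi> (rescaled a n k)) / sqrt (real n) - gauss_moment \<beta> h a \<phi>\<bar>
       \<le> D / sqrt (real n)"
    unfolding laplace_limit_def by blast
  then have "\<forall>\<^sub>F n in sequentially. norm ((\<Sum>k\<in>K n. scaled_weight \<beta> h a n k) / sqrt (real n) - exp_nu a * q_weight \<beta> h a)
      \<le> D / sqrt (real n)"
    by eventually_elim (use test_function_one gauss_moment_one in fastforce)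
  then show ?thesis
    by (intro LIM_zero_cancel[OF Lim_null_comparison[OF _ tendsto_const_over_sqrt]])
qed

text \<open>The condition e \<le> Y/2 keeps the perturbed denominator above Y/2; J replaces the
  numerator by a uniform bound.\<close>

lemma ratio_error_bound:
  fixes x y X Y e J :: real
  assumes "\<bar>x - X\<bar> \<le> e" "\<bar>y - Y\<bar> \<le> e" "Y > 0" "e \<le> Y / 2" "\<bar>X\<bar> \<le> J"
  shows "\<bar>x / y - X / Y\<bar> \<le> e * (2 * (Y + J) / Y\<^sup>2)"
proof -
  have y: "y \<ge> Y / 2" using assms(2,4) by linarith
  then have y0: "y > 0" using assms(3) by linarith
  have "\<bar>x / y - X / Y\<bar> = \<bar>(x - X) * Y + X * (Y - y)\<bar> / (y * Y)"
  proof -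
    have "x / y - X / Y = ((x - X) * Y + X * (Y - y)) / (y * Y)"
      using y0 assms(3) by (simp add: field_simps)
    then show ?thesis using y0 assms(3) by (simp add: abs_divide)
  qed
  also have "\<dots> \<le> (e * (Y + J)) / (Y / 2 * Y)"
  proof (rule frac_le)
    have "\<bar>(x - X) * Y + X * (Y - y)\<bar> \<le> \<bar>x - X\<bar> * Y + \<bar>X\<bar> * \<bar>Y - y\<bar>"
      using abs_triangle_ineq[of "(x - X) * Y" "X * (Y - y)"] assms(3) by (simp add: abs_mult)
    also have "\<dots> \<le> e * Y + J * e"
      using assms by (intro add_mono mult_mono) (auto simp: abs_minus_commute)
    finally show "\<bar>(x - X) * Y + X * (Y - y)\<bar> \<le> e * (Y + J)" by (simp add: algebra_simps)
    show "Y / 2 * Y \<le> y * Y" using y assms(3) by (intro mult_right_mono) auto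
  qed (use assms in auto)
  also have "\<dots> = e * (2 * (Y + J) / Y\<^sup>2)" by (simp add: power2_eq_square)
  finally show ?thesis .
qed

text \<open>The weighted sum is divided by the one for the constant function 1. A Lipschitz f may be
  huge at 0, so f(2y) - f(0) is used as test function; the constant f(0) has the same expectation
  under both normalized laws and cancels.\<close>

lemma laplace_limit_expectation:
  assumes lim: "laplace_limit \<beta> h a K" and a: "0 < a" "a < 1" and neg: "A_second \<beta> h a < 0"
  obtains C where "\<forall>\<^sub>F n in sequentially. (\<Sum>k\<in>K n. scaled_weight \<beta> h a n k) > 0 \<and>
    (\<forall>f. 1-lipschitz_on UNIV f \<longrightarrow>
      \<bar>(\<Sum>k\<in>K n. scaled_weight \<beta> h a n k * f (2 * rescaled a n k)) / (\<Sum>k\<in>K n. scaled_weight \<beta> h a n k)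
        - (\<integral>x. f x \<partial>centered_normal (4 / \<bar>A_second \<beta> h a\<bar>))\<bar> \<le> C / sqrt (real n))"
proof -
  define s where "s = A_second \<beta> h a"
  define V where "V = scaled_weight \<beta> h a"
  define I where "I = gauss_moment \<beta> h a"
  define Y where "Y = I (\<lambda>_. 1)"
  define J where "J = 2 * I (\<lambda>y. 1 + \<bar>y\<bar>)"
  have Y: "Y > 0" unfolding Y_def I_def by (rule gauss_moment_one_pos[OF a neg])
  obtain D where D: "\<forall>\<^sub>F n in sequentially. \<forall>\<phi>. test_function \<phi> \<longrightarrow>
     \<bar>(\<Sum>k\<in>K n. V n k * \<phi> (rescaled a n k)) / sqrt (real n) - I \<phi>\<bar> \<le> D / sqrt (real n)"
    using lim unfolding laplace_limit_def V_def I_def by blast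
  have "\<forall>\<^sub>F n in sequentially. D / sqrt (real n) < Y / 2"
    by (rule order_tendstoD(2)[OF tendsto_const_over_sqrt]) (use Y in simp)
  with D eventually_ge_at_top[of 1] have "\<forall>\<^sub>F n in sequentially. (\<Sum>k\<in>K n. V n k) > 0 \<and>
    (\<forall>f. 1-lipschitz_on UNIV f \<longrightarrow>
      \<bar>(\<Sum>k\<in>K n. V n k * f (2 * rescaled a n k)) / (\<Sum>k\<in>K n. V n k)
        - (\<integral>x. f x \<partial>centered_normal (4 / \<bar>s\<bar>))\<bar> \<le> D * (2 * (Y + J) / Y\<^sup>2) / sqrt (real n))"
  proof eventually_elim
    case (elim n)
    define T where "T = (\<Sum>k\<in>K n. V n k)"
    have n: "sqrt (real n) > 0" using elim(2) by simp
    have T1: "\<bar>T / sqrt (real n) - Y\<bar> \<le> D / sqrt (real n)"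
      using elim(1)[rule_format, OF test_function_one] by (simp add: T_def Y_def)
    have "T / sqrt (real n) > 0" using T1 elim(3) Y by linarith
    from mult_pos_pos[OF this n] have T: "T > 0" using n by simp
    have "\<bar>(\<Sum>k\<in>K n. V n k * f (2 * rescaled a n k)) / T
        - (\<integral>x. f x \<partial>centered_normal (4 / \<bar>s\<bar>))\<bar> \<le> D * (2 * (Y + J) / Y\<^sup>2) / sqrt (real n)"
      if f: "1-lipschitz_on UNIV f" for f
    proof -
      define \<phi> where "\<phi> y = f (2 * y) - f 0" for y
      have \<phi>: "test_function \<phi>"
        unfolding test_function_def \<phi>_def
      proof (intro conjI allI)
        fix x y show "\<bar>f (2 * x) - f 0 - (f (2 * y) - f 0)\<bar> \<le> 2 * \<bar>x - y\<bar>"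
        proof -
          have "\<bar>f (2 * x) - f (2 * y)\<bar> \<le> \<bar>2 * x - 2 * y\<bar>"
            using lipschitz_onD[OF f, of "2 * x" "2 * y"] by (simp add: dist_real_def)
          also have "2 * x - 2 * y = 2 * (x - y)" by simp
          finally show ?thesis unfolding abs_mult by simp
        qed
      qed simp
      have w: "s < 0" using neg by (simp add: s_def)
      define Q where "Q = (\<integral>y. exp (1/2 * s * y\<^sup>2) \<partial>lborel)"
      have Q: "Q > 0" unfolding Q_def by (rule normal_expectation(1)[OF w, of "\<lambda>_. 0"]) simp
      have fphi: "f (2 * y) = \<phi> y + f 0" for y by (simp add: \<phi>_def)
      have sums: "(\<Sum>k\<in>K n. V n k * f (2 * rescaled a n k)) / T
          = ((\<Sum>k\<in>K n. V n k * \<phi> (rescaled a n k)) / sqrt (real n)) / (T / sqrt (real n)) + f 0"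
        unfolding fphi using T n
        by (simp add: distrib_left sum.distrib sum_distrib_right[symmetric] T_def add_divide_distrib)
      \<comment> \<open>The factors 1 bring both integrands into the form of
        \<open>integrable_test_gauss\<close> with S = 1.\<close>
      have "(\<integral>y. f (2 * y) * exp (1/2 * s * y\<^sup>2) \<partial>lborel)
          = (\<integral>y. \<phi> y * (1 * exp (1/2 * s * y\<^sup>2)) + f 0 * (1 * (1 * exp (1/2 * s * y\<^sup>2))) \<partial>lborel)"
        unfolding fphi by (simp add: distrib_right)
      also have "\<dots> = (\<integral>y. \<phi> y * exp (1/2 * s * y\<^sup>2) \<partial>lborel) + f 0 * Q"
        using integrable_test_gauss[OF \<phi> w, of 1] integrable_test_gauss[OF test_function_one w, of 1]
        by (subst Bochner_Integration.integral_add) (auto simp: Q_def)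
      finally have "(\<integral>x. f x \<partial>centered_normal (4 / \<bar>s\<bar>)) = (\<integral>y. \<phi> y * exp (1/2 * s * y\<^sup>2) \<partial>lborel) / Q + f 0"
        using normal_expectation(2)[OF w lipschitz_borel[OF f]] Q by (simp add: Q_def add_divide_distrib)
      moreover have "I \<phi> = exp_nu a * (\<integral>y. \<phi> y * exp (1/2 * s * y\<^sup>2) \<partial>lborel)" "Y = exp_nu a * Q"
        by (simp_all add: I_def Y_def gauss_moment_def s_def Q_def mult.left_commute)
      moreover have "exp_nu a > 0" using a by (simp add: exp_nu_eq)
      ultimately have normal: "(\<integral>x. f x \<partial>centered_normal (4 / \<bar>s\<bar>)) = I \<phi> / Y + f 0" by simp
      have "\<bar>I \<phi>\<bar> \<le> J" unfolding I_def J_def by (rule gauss_moment_bound[OF \<phi> neg])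
      from ratio_error_bound[OF elim(1)[rule_format, OF \<phi>] T1 Y less_imp_le[OF elim(3)] this]
      show ?thesis unfolding sums normal by (simp only: add_diff_cancel_right times_divide_eq_left)
    qed
    then show ?case using T by (simp add: T_def)
  qed
  then show thesis using that unfolding V_def s_def by blast
qed

lemma two_regular_derivs:
  assumes "two_regular \<beta> h a" "0 < a" "a < 1"
  shows "A_d1 \<beta> h a = 0" "A_second \<beta> h a < 0"
  using assms DERIV_unique[OF has_derivative_A_fun[OF assms(2,3)]]
  unfolding two_regular_def by auto

lemma laplace_limit_window:
  assumes "two_regular \<beta> h a" "0 < a" "a < 1"
  obtains r0 where "0 < r0" "r0 < a" "a + r0 < 1"
    "\<And>r. 0 < r \<Longrightarrow> r \<le> r0 \<Longrightarrow> laplace_limit \<beta> h a (window a r)"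
  using window_laplace[OF assms(2,3) two_regular_derivs[OF assms]] by blast

abbreviation total_weight :: "real \<Rightarrow> real \<Rightarrow> real \<Rightarrow> nat \<Rightarrow> nat set \<Rightarrow> real" where
  "total_weight \<beta> h a n K \<equiv> (\<Sum>k\<in>K. scaled_weight \<beta> h a n k)"

lemma total_weight_mono: "finite L \<Longrightarrow> K \<subseteq> L \<Longrightarrow> total_weight \<beta> h a n K \<le> total_weight \<beta> h a n L"
  by (intro sum_mono2) (auto simp: scaled_weight_nonneg)

lemma total_weight_nonneg: "total_weight \<beta> h a n K \<ge> 0"
  by (intro sum_nonneg) (auto simp: scaled_weight_nonneg)

lemma total_weight_pos: "n \<ge> 1 \<Longrightarrow> total_weight \<beta> h a n {..n} > 0"
  by (intro sum_pos scaled_weight_pos) auto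

section \<open>Exponential concentration near the maximizers\<close>

lemma far_set_tendsto:
  assumes m: "m \<in> maximizers \<beta> h" and r: "r > 0"
  shows "(\<lambda>n. total_weight \<beta> h m n (far_set \<beta> h r n) / sqrt (real n)) \<longlonglongrightarrow> 0"
proof -
  obtain \<eta> where \<eta>: "\<eta> > 0" and far: "\<And>n. n \<ge> 1 \<Longrightarrow> total_weight \<beta> h m n (far_set \<beta> h r n)
     \<le> (real n + 1) * (exp stirling_const * sqrt (real n) * exp (- \<eta> * real n))"
    using far_set_sum_bound[OF m r] by metis
  have lim: "(\<lambda>n. (real n + 1) * (exp stirling_const * exp (- \<eta> * real n))) \<longlonglongrightarrow> 0"
    using \<eta> by real_asymp
  show ?thesis
  proof (rule Lim_null_comparison[OF _ lim])
    show "\<forall>\<^sub>F n in sequentially. norm (total_weight \<beta> h m n (far_set \<beta> h r n) / sqrt (real n))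
       \<le> (real n + 1) * (exp stirling_const * exp (- \<eta> * real n))"
      using eventually_ge_at_top[of 1]
    proof eventually_elim
      case (elim n)
      then have "sqrt (real n) > 0" by simp
      then show ?case using far[OF elim] total_weight_nonneg[of \<beta> h m n "far_set \<beta> h r n"]
        by (simp add: pos_divide_le_eq mult_ac)
    qed
  qed
qed

text \<open>A single window already makes the total weight at least a multiple of sqrt n, while the
  far weights are exponentially small. Neither step depends on the number of maximizers.\<close>

lemma far_set_prob:
  assumes reg: "two_regular \<beta> h a" and a: "0 < a" "a < 1" and r: "r > 0"
  shows "\<exists>c>0. \<forall>\<^sub>F n in sequentially.
    total_weight \<beta> h a n (far_set \<beta> h r n) / total_weight \<beta> h a n {..n} \<le> exp (- c * real n)"
proof -
  have am: "a \<in> maximizers \<beta> h" using reg by (simp add: two_regular_def)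
  obtain r0 where r0: "0 < r0" "laplace_limit \<beta> h a (window a r0)"
    using laplace_limit_window[OF reg a] by blast
  define L where "L = exp_nu a * q_weight \<beta> h a"
  have L: "L > 0"
    unfolding L_def gauss_moment_one[symmetric]
    by (rule gauss_moment_one_pos[OF a two_regular_derivs(2)[OF reg a]])
  obtain \<eta> where \<eta>: "\<eta> > 0" and far: "\<And>n. n \<ge> 1 \<Longrightarrow> total_weight \<beta> h a n (far_set \<beta> h r n)
     \<le> (real n + 1) * (exp stirling_const * sqrt (real n) * exp (- \<eta> * real n))"
    using far_set_sum_bound[OF am r] by metis
  have "\<forall>\<^sub>F n in sequentially. L / 2 < total_weight \<beta> h a n (window a r0 n) / sqrt (real n)"
    using laplace_limit_total[OF r0(2)] L by (intro order_tendstoD(1)) (auto simp: L_def)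
  \<comment> \<open>Half of the rate \<eta> is spent on the polynomial factor; the other half is the
    rate obtained.\<close>
  moreover have "(\<lambda>n. (real n + 1) * (2 * exp stirling_const / L) * exp (- (\<eta> / 2) * real n)) \<longlonglongrightarrow> 0"
    using \<eta> L by real_asymp
  then have "\<forall>\<^sub>F n in sequentially. (real n + 1) * (2 * exp stirling_const / L) * exp (- (\<eta> / 2) * real n) < 1"
    by (rule order_tendstoD(2)) simp
  ultimately have "\<forall>\<^sub>F n in sequentially.
    total_weight \<beta> h a n (far_set \<beta> h r n) / total_weight \<beta> h a n {..n} \<le> exp (- (\<eta> / 2) * real n)"
    using eventually_ge_at_top[of 1]
  proof eventually_elim
    case (elim n)
    have n: "sqrt (real n) > 0" using elim(3) by simp
    have "L / 2 * sqrt (real n) \<le> total_weight \<beta> h a n (window a r0 n)"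
      using elim(1) n by (simp add: pos_less_divide_eq)
    also have "\<dots> \<le> total_weight \<beta> h a n {..n}"
      by (rule total_weight_mono) (auto simp: window_def)
    finally have "total_weight \<beta> h a n (far_set \<beta> h r n) / total_weight \<beta> h a n {..n}
      \<le> ((real n + 1) * (exp stirling_const * sqrt (real n) * exp (- \<eta> * real n))) / (L / 2 * sqrt (real n))"
      using far[OF elim(3)] n L by (intro frac_le) auto
    also have "\<dots> = (real n + 1) * (2 * exp stirling_const / L) * exp (- \<eta> * real n)"
      using n L by (simp add: field_simps)
    also have "\<dots> = ((real n + 1) * (2 * exp stirling_const / L) * exp (- (\<eta> / 2) * real n)) * exp (- (\<eta> / 2) * real n)"
      by (simp add: mult.assoc exp_add[symmetric])
    also have "\<dots> \<le> 1 * exp (- (\<eta> / 2) * real n)"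
      using elim(2) by (intro mult_right_mono) auto
    finally show ?case by simp
  qed
  then show ?thesis using \<eta> by (intro exI[of _ "\<eta> / 2"]) auto
qed

lemma far_set_prob_tendsto:
  assumes "two_regular \<beta> h a" "0 < a" "a < 1" "r > 0"
  shows "(\<lambda>n. total_weight \<beta> h a n (far_set \<beta> h r n) / total_weight \<beta> h a n {..n}) \<longlonglongrightarrow> 0"
proof -
  obtain c where c: "c > 0" "\<forall>\<^sub>F n in sequentially.
    total_weight \<beta> h a n (far_set \<beta> h r n) / total_weight \<beta> h a n {..n} \<le> exp (- c * real n)"
    using far_set_prob[OF assms] by blast
  have lim: "(\<lambda>n. exp (- c * real n)) \<longlonglongrightarrow> 0" using c(1) by real_asymp
  show ?thesis
    by (rule Lim_null_comparison[OF _ lim], rule eventually_mono[OF c(2)])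
      (simp add: total_weight_nonneg)
qed

lemma concentration:
  assumes reg: "two_regular \<beta> h a" "0 < a" "a < 1" and \<delta>: "\<delta> > 0"
  shows "\<exists>c>0. \<forall>\<^sub>F n in sequentially. measure (gibbs \<beta> h n)
     {\<omega> \<in> space (gibbs \<beta> h n). \<forall>b\<in>maximizers \<beta> h. \<bar>magnetization n \<omega> / real n - (2 * b - 1)\<bar> > \<delta>}
     \<le> exp (- c * real n)"
proof -
  obtain c where c: "c > 0" "\<forall>\<^sub>F n in sequentially.
    total_weight \<beta> h a n (far_set \<beta> h (\<delta>/2) n) / total_weight \<beta> h a n {..n} \<le> exp (- c * real n)"
    using far_set_prob[OF reg, of "\<delta>/2"] \<delta> by auto
  have "\<forall>\<^sub>F n in sequentially. measure (gibbs \<beta> h n)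
     {\<omega> \<in> space (gibbs \<beta> h n). \<forall>b\<in>maximizers \<beta> h. \<bar>magnetization n \<omega> / real n - (2 * b - 1)\<bar> > \<delta>}
     \<le> exp (- c * real n)"
    using c(2) eventually_ge_at_top[of 1]
  proof eventually_elim
    case (elim n)
    have "{k. k \<le> n \<and> k \<in> far_set \<beta> h (\<delta>/2) n} = far_set \<beta> h (\<delta>/2) n"
      by (auto simp: far_set_def)
    moreover have "plus_count n \<omega> \<in> far_set \<beta> h (\<delta>/2) n \<longleftrightarrow>
        (\<forall>b\<in>maximizers \<beta> h. \<bar>magnetization n \<omega> / real n - (2 * b - 1)\<bar> > \<delta>)"
      if "\<omega> \<in> configs n" for \<omega>
      using window_event[OF that elim(2)] plus_count_le[of n \<omega>]
      by (auto simp: far_set_def window_def not_le[symmetric])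
    ultimately show ?case using elim
      by (subst gibbs_measure[where a = a and K = "far_set \<beta> h (\<delta>/2) n"]) auto
  qed
  with c(1) show ?thesis by blast
qed

text \<open>With one maximizer, a window and its far set partition {0,...,n}. On the far set test
  functions reach order sqrt n, still negligible against the exponentially small weights.\<close>

lemma laplace_limit_full:
  assumes uniq: "maximizers \<beta> h = {a}" and reg: "two_regular \<beta> h a" "0 < a" "a < 1"
  shows "laplace_limit \<beta> h a (\<lambda>n. {..n})"
proof -
  obtain r where r: "0 < r" "laplace_limit \<beta> h a (window a r)"
    using laplace_limit_window[OF reg] by blast
  obtain D where D: "D \<ge> 0" "\<forall>\<^sub>F n in sequentially. \<forall>\<phi>. test_function \<phi> \<longrightarrow>
     \<bar>(\<Sum>k\<in>window a r n. scaled_weight \<beta> h a n k * \<phi> (rescaled a n k)) / sqrt (real n) - gauss_moment \<beta> h a \<phi>\<bar>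
       \<le> D / sqrt (real n)"
    using r(2) unfolding laplace_limit_def by blast
  have am: "a \<in> maximizers \<beta> h" using uniq by simp
  obtain \<eta> where \<eta>: "\<eta> > 0" and far: "\<And>n. n \<ge> 1 \<Longrightarrow> total_weight \<beta> h a n (far_set \<beta> h r n)
     \<le> (real n + 1) * (exp stirling_const * sqrt (real n) * exp (- \<eta> * real n))"
    using far_set_sum_bound[OF am r(1)] by metis
  \<comment> \<open>The last factor bounds every test function on the whole lattice, where the
    rescaled coordinate is at most sqrt n. The resulting bound 1 on the far sum is the increment in
    D + 1.\<close>
  have "(\<lambda>n. (real n + 1) * (exp stirling_const * sqrt (real n) * exp (- \<eta> * real n)) * (2 * (1 + sqrt (real n)))) \<longlonglongrightarrow> 0"
    using \<eta> by real_asymp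
  then have "\<forall>\<^sub>F n in sequentially.
      (real n + 1) * (exp stirling_const * sqrt (real n) * exp (- \<eta> * real n)) * (2 * (1 + sqrt (real n))) < 1"
    by (rule order_tendstoD(2)) simp
  with D(2) eventually_ge_at_top[of 1] have "\<forall>\<^sub>F n in sequentially. \<forall>\<phi>. test_function \<phi> \<longrightarrow>
     \<bar>(\<Sum>k\<le>n. scaled_weight \<beta> h a n k * \<phi> (rescaled a n k)) / sqrt (real n) - gauss_moment \<beta> h a \<phi>\<bar>
       \<le> (D + 1) / sqrt (real n)"
  proof eventually_elim
    case (elim n)
    have n: "sqrt (real n) > 0" using elim(2) by simp
    show ?case
    proof (intro allI impI)
      fix \<phi> assume \<phi>: "test_function \<phi>"
      define u where "u k = scaled_weight \<beta> h a n k * \<phi> (rescaled a n k)" for k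
      have "{..n} = window a r n \<union> far_set \<beta> h r n" "window a r n \<inter> far_set \<beta> h r n = {}"
        using uniq by (auto simp: window_def far_set_def)
      then have split: "sum u {..n} = sum u (window a r n) + sum u (far_set \<beta> h r n)"
        by (simp add: sum.union_disjoint)
      have "\<bar>sum u (far_set \<beta> h r n)\<bar> \<le> (\<Sum>k\<in>far_set \<beta> h r n. scaled_weight \<beta> h a n k * (2 * (1 + sqrt (real n))))"
      proof (rule order_trans[OF sum_abs sum_mono])
        fix k assume "k \<in> far_set \<beta> h r n"
        then have k: "real k \<le> real n" by (simp add: far_set_def)
        have "real n * a \<le> real n" "0 \<le> real n * a" using reg by (simp_all add: mult_left_le)
        with k have "\<bar>real k - real n * a\<bar> \<le> real n" by linarith
        then have "\<bar>rescaled a n k\<bar> \<le> real n / sqrt (real n)"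
          unfolding rescaled_def abs_divide using n by (simp add: divide_right_mono)
        then have "\<bar>rescaled a n k\<bar> \<le> sqrt (real n)" by (simp add: real_div_sqrt)
        then have "\<bar>\<phi> (rescaled a n k)\<bar> \<le> 2 * (1 + sqrt (real n))"
          using test_function_bound[OF \<phi>, of "rescaled a n k"] by simp
        then show "\<bar>u k\<bar> \<le> scaled_weight \<beta> h a n k * (2 * (1 + sqrt (real n)))"
          unfolding u_def abs_mult using scaled_weight_nonneg[of \<beta> h a n k] by (intro mult_mono) auto
      qed
      also have "\<dots> = total_weight \<beta> h a n (far_set \<beta> h r n) * (2 * (1 + sqrt (real n)))"
        by (rule sum_distrib_right[symmetric])
      also have "\<dots> \<le> 1"
        by (rule order_trans[OF mult_right_mono[OF far[OF elim(2)]] less_imp_le[OF elim(3)]]) (use n in simp)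
      finally have "\<bar>sum u (far_set \<beta> h r n) / sqrt (real n)\<bar> \<le> 1 / sqrt (real n)"
        unfolding abs_divide using n by (simp add: divide_right_mono)
      moreover have "\<bar>sum u (window a r n) / sqrt (real n) - gauss_moment \<beta> h a \<phi>\<bar> \<le> D / sqrt (real n)"
        using elim(1) \<phi> unfolding u_def by blast
      moreover have "sum u {..n} / sqrt (real n) = sum u (window a r n) / sqrt (real n) + sum u (far_set \<beta> h r n) / sqrt (real n)"
        by (simp add: split add_divide_distrib)
      moreover have "(D + 1) / sqrt (real n) = D / sqrt (real n) + 1 / sqrt (real n)" by (rule add_divide_distrib)
      ultimately show "\<bar>sum u {..n} / sqrt (real n) - gauss_moment \<beta> h a \<phi>\<bar> \<le> (D + 1) / sqrt (real n)"
        by linarith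
    qed
  qed
  then show ?thesis using D(1) unfolding laplace_limit_def by (intro exI[of _ "D + 1"]) auto
qed

section \<open>Wasserstein bounds for the full and the conditional laws\<close>

lemma wasserstein_full:
  assumes uniq: "maximizers \<beta> h = {a}" and reg: "two_regular \<beta> h a" "0 < a" "a < 1"
  shows "\<exists>C. \<forall>\<^sub>F n in sequentially. wasserstein (fluctuation_law \<beta> h n (2 * a - 1))
      (centered_normal (4 / \<bar>A_second \<beta> h a\<bar>)) \<le> ennreal (C / sqrt (real n))"
proof -
  obtain C where C: "\<forall>\<^sub>F n in sequentially. total_weight \<beta> h a n {..n} > 0 \<and>
    (\<forall>f. 1-lipschitz_on UNIV f \<longrightarrow>
      \<bar>(\<Sum>k\<le>n. scaled_weight \<beta> h a n k * f (2 * rescaled a n k)) / total_weight \<beta> h a n {..n}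
        - (\<integral>x. f x \<partial>centered_normal (4 / \<bar>A_second \<beta> h a\<bar>))\<bar> \<le> C / sqrt (real n))"
    by (rule laplace_limit_expectation[OF laplace_limit_full[OF assms] reg(2,3) two_regular_derivs(2)[OF reg]])
  from C eventually_ge_at_top[of 1]
  have "\<forall>\<^sub>F n in sequentially. wasserstein (fluctuation_law \<beta> h n (2 * a - 1))
      (centered_normal (4 / \<bar>A_second \<beta> h a\<bar>)) \<le> ennreal (C / sqrt (real n))"
  proof eventually_elim
    case (elim n)
    show ?case
    proof (rule wasserstein_leI)
      fix f :: "real \<Rightarrow> real" assume f: "1-lipschitz_on UNIV f"
      show "\<bar>(\<integral>x. f x \<partial>fluctuation_law \<beta> h n (2 * a - 1))
          - (\<integral>x. f x \<partial>centered_normal (4 / \<bar>A_second \<beta> h a\<bar>))\<bar> \<le> C / sqrt (real n)"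
        unfolding fluctuation_law_expectation[OF elim(2) lipschitz_borel[OF f]] using elim(1) f by blast
    qed
  qed
  then show ?thesis by blast
qed

text \<open>Under conditioning, numerator and normalization are sums over the same window, so the
  other phase never enters.\<close>

lemma wasserstein_window:
  assumes reg: "two_regular \<beta> h a" "0 < a" "a < 1"
  shows "\<exists>\<delta>0>0. \<forall>\<delta>. 0 < \<delta> \<and> \<delta> < \<delta>0 \<longrightarrow> (\<exists>C. \<forall>\<^sub>F n in sequentially.
     wasserstein (cond_fluctuation_law \<beta> h n (2 * a - 1) \<delta>)
      (centered_normal (4 / \<bar>A_second \<beta> h a\<bar>)) \<le> ennreal (C / sqrt (real n)))"
proof -
  obtain r0 where r0: "0 < r0" "\<And>r. 0 < r \<Longrightarrow> r \<le> r0 \<Longrightarrow> laplace_limit \<beta> h a (window a r)"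
    using laplace_limit_window[OF reg] by metis
  have "\<exists>C. \<forall>\<^sub>F n in sequentially. wasserstein (cond_fluctuation_law \<beta> h n (2 * a - 1) \<delta>)
      (centered_normal (4 / \<bar>A_second \<beta> h a\<bar>)) \<le> ennreal (C / sqrt (real n))" if \<delta>: "0 < \<delta>" "\<delta> < r0" for \<delta>
  proof -
    have lim: "laplace_limit \<beta> h a (window a (\<delta>/2))" using \<delta> by (intro r0(2)) auto
    obtain C where C: "\<forall>\<^sub>F n in sequentially. total_weight \<beta> h a n (window a (\<delta>/2) n) > 0 \<and>
      (\<forall>f. 1-lipschitz_on UNIV f \<longrightarrow>
        \<bar>(\<Sum>k\<in>window a (\<delta>/2) n. scaled_weight \<beta> h a n k * f (2 * rescaled a n k))
            / total_weight \<beta> h a n (window a (\<delta>/2) n)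
          - (\<integral>x. f x \<partial>centered_normal (4 / \<bar>A_second \<beta> h a\<bar>))\<bar> \<le> C / sqrt (real n))"
      by (rule laplace_limit_expectation[OF lim reg(2,3) two_regular_derivs(2)[OF reg]])
    from C eventually_ge_at_top[of 1]
    have "\<forall>\<^sub>F n in sequentially. wasserstein (cond_fluctuation_law \<beta> h n (2 * a - 1) \<delta>)
        (centered_normal (4 / \<bar>A_second \<beta> h a\<bar>)) \<le> ennreal (C / sqrt (real n))"
    proof eventually_elim
      case (elim n)
      then have ne: "total_weight \<beta> h a n (window a (\<delta>/2) n) \<noteq> 0" by simp
      show ?case
      proof (rule wasserstein_leI)
        fix f :: "real \<Rightarrow> real" assume f: "1-lipschitz_on UNIV f"
        show "\<bar>(\<integral>x. f x \<partial>cond_fluctuation_law \<beta> h n (2 * a - 1) \<delta>)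
            - (\<integral>x. f x \<partial>centered_normal (4 / \<bar>A_second \<beta> h a\<bar>))\<bar> \<le> C / sqrt (real n)"
          unfolding cond_fluctuation_law_expectation[OF elim(2) lipschitz_borel[OF f] ne] using elim(1) f by blast
      qed
    qed
    then show ?thesis by blast
  qed
  with r0(1) show ?thesis by blast
qed

section \<open>Weak convergence of the magnetization\<close>

lemma cdf_density_law:
  assumes n: "n \<ge> 1"
  shows "cdf (density_law \<beta> h n) x
    = total_weight \<beta> h a n {k. k \<le> n \<and> 2 * (real k / real n) - 1 \<le> x} / total_weight \<beta> h a n {..n}"
proof -
  have mag: "magnetization n \<omega> / real n = 2 * (real (plus_count n \<omega>) / real n) - 1" if "\<omega> \<in> configs n" for \<omega>
    using magnetization_eq[OF that] n by (simp add: field_simps)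
  have "cdf (density_law \<beta> h n) x
    = measure (gibbs \<beta> h n) ((\<lambda>\<omega>. magnetization n \<omega> / real n) -` {..x} \<inter> space (gibbs \<beta> h n))"
    unfolding cdf_def density_law_def by (subst measure_distr) auto
  also have "\<dots> = total_weight \<beta> h a n {k. k \<le> n \<and> k \<in> {k. 2 * (real k / real n) - 1 \<le> x}} / total_weight \<beta> h a n {..n}"
    using mag by (intro gibbs_measure[OF n]) auto
  finally show ?thesis by simp
qed

text \<open>The margin 2r on the magnetization scale is r on the scale of k/n, so every k counted by
  the distribution function at x is far from all maximizers.\<close>

lemma cdf_density_law_below:
  assumes reg: "two_regular \<beta> h a" "0 < a" "a < 1" and r: "r > 0"
    and below: "\<And>b. b \<in> maximizers \<beta> h \<Longrightarrow> x + 2 * r < 2 * b - 1"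
  shows "(\<lambda>n. cdf (density_law \<beta> h n) x) \<longlonglongrightarrow> 0"
proof (rule Lim_null_comparison[OF _ far_set_prob_tendsto[OF reg r]])
  show "\<forall>\<^sub>F n in sequentially. norm (cdf (density_law \<beta> h n) x)
      \<le> total_weight \<beta> h a n (far_set \<beta> h r n) / total_weight \<beta> h a n {..n}"
    using eventually_ge_at_top[of 1]
  proof eventually_elim
    case (elim n)
    have "{k. k \<le> n \<and> 2 * (real k / real n) - 1 \<le> x} \<subseteq> far_set \<beta> h r n"
      unfolding far_set_def using below by fastforce
    from total_weight_mono[OF finite_far_set this] total_weight_pos[OF elim]
    show ?case
      unfolding cdf_density_law[OF elim, of \<beta> h x a]
      by (simp add: total_weight_nonneg divide_right_mono less_imp_le)
  qed
qed

text \<open>The mirror case: the k not counted at x are the far ones, so 1 minus the distribution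
  function tends to 0.\<close>

lemma cdf_density_law_above:
  assumes reg: "two_regular \<beta> h a" "0 < a" "a < 1" and r: "r > 0"
    and above: "\<And>b. b \<in> maximizers \<beta> h \<Longrightarrow> 2 * b - 1 < x - 2 * r"
  shows "(\<lambda>n. cdf (density_law \<beta> h n) x) \<longlonglongrightarrow> 1"
proof (rule LIM_zero_cancel[OF Lim_null_comparison[OF _ far_set_prob_tendsto[OF reg r]]])
  show "\<forall>\<^sub>F n in sequentially. norm (cdf (density_law \<beta> h n) x - 1)
      \<le> total_weight \<beta> h a n (far_set \<beta> h r n) / total_weight \<beta> h a n {..n}"
    using eventually_ge_at_top[of 1]
  proof eventually_elim
    case (elim n)
    define K where "K = {k. k \<le> n \<and> 2 * (real k / real n) - 1 \<le> x}"
    define T where "T = total_weight \<beta> h a n {..n}"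
    have T: "T > 0" unfolding T_def by (rule total_weight_pos[OF elim])
    have "K \<subseteq> {..n}" by (auto simp: K_def)
    then have "total_weight \<beta> h a n K - T = - total_weight \<beta> h a n ({..n} - K)"
      unfolding T_def by (subst sum_diff) auto
    then have "norm (total_weight \<beta> h a n K / T - 1) = total_weight \<beta> h a n ({..n} - K) / T"
      using T total_weight_nonneg[of \<beta> h a n "{..n} - K"]
      by (simp add: diff_divide_eq_iff divide_diff_eq_iff abs_divide)
    moreover have "{..n} - K \<subseteq> far_set \<beta> h r n"
      unfolding far_set_def K_def using above by fastforce
    ultimately show ?case
      unfolding cdf_density_law[OF elim, of \<beta> h x a] K_def[symmetric] T_def[symmetric]
      using total_weight_mono[OF finite_far_set] T by (simp add: divide_right_mono less_imp_le)
  qed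
qed

text \<open>Serves to exclude atoms: at a continuity point the value equals the constant taken just
  to the left, which a jump contradicts.\<close>

lemma isCont_left_const:
  fixes F :: "real \<Rightarrow> real"
  assumes "isCont F x" "y < x" "\<And>z. y < z \<Longrightarrow> z < x \<Longrightarrow> F z = c"
  shows "F x = c"
proof -
  have "(F \<longlongrightarrow> F x) (at_left x)"
    using assms(1) unfolding isCont_def by (rule tendsto_mono[OF at_le[OF subset_UNIV]])
  moreover have "\<forall>\<^sub>F z in at_left x. F z = c"
    unfolding eventually_at_left_field using assms(2,3) by blast
  then have "(F \<longlongrightarrow> c) (at_left x)" by (rule tendsto_eventually)
  ultimately show ?thesis using tendsto_unique[OF trivial_limit_at_left_real] by blast
qed

lemma density_law_weak_conv_unique:
  assumes uniq: "maximizers \<beta> h = {a}" and reg: "two_regular \<beta> h a" "0 < a" "a < 1"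
  shows "weak_conv_m (density_law \<beta> h) (return borel (2 * a - 1))"
  unfolding weak_conv_m_def weak_conv_def
proof (intro allI impI)
  define m where "m = 2 * a - 1"
  have F: "cdf (return borel m) y = (if m \<le> y then 1 else 0)" for y
    unfolding cdf_def by (subst measure_return) (simp_all add: indicator_def)
  fix x assume cont: "isCont (cdf (return borel (2 * a - 1))) x"
  have cont_m: "isCont (cdf (return borel m)) x" using cont by (simp only: m_def)
  have "x \<noteq> m"
  proof
    assume x: "x = m"
    have "cdf (return borel m) x = 0"
      by (rule isCont_left_const[OF cont_m, of "x - 1"]) (simp_all add: F x)
    then show False by (simp add: F x)
  qed
  then consider "x < m" | "m < x" by linarith
  then show "(\<lambda>n. cdf (density_law \<beta> h n) x) \<longlonglongrightarrow> cdf (return borel (2 * a - 1)) x"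
    unfolding m_def[symmetric]
  proof cases
    case 1
    have "(\<lambda>n. cdf (density_law \<beta> h n) x) \<longlonglongrightarrow> 0"
    proof (rule cdf_density_law_below[OF reg])
      \<comment> \<open>A quarter of the distance, so that 2r remains strictly below it.\<close>
      show "0 < (m - x) / 4" using 1 by simp
      show "x + 2 * ((m - x) / 4) < 2 * c - 1" if "c \<in> maximizers \<beta> h" for c
        using that 1 uniq by (auto simp: m_def field_simps)
    qed
    then show "(\<lambda>n. cdf (density_law \<beta> h n) x) \<longlonglongrightarrow> cdf (return borel m) x"
      using 1 by (simp add: F)
  next
    case 2
    have "(\<lambda>n. cdf (density_law \<beta> h n) x) \<longlonglongrightarrow> 1"
    proof (rule cdf_density_law_above[OF reg])
      show "0 < (x - m) / 4" using 2 by simp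
      show "2 * c - 1 < x - 2 * ((x - m) / 4)" if "c \<in> maximizers \<beta> h" for c
        using that 2 uniq by (auto simp: m_def field_simps)
    qed
    then show "(\<lambda>n. cdf (density_law \<beta> h n) x) \<longlonglongrightarrow> cdf (return borel m) x"
      using 2 by (simp add: F)
  qed
qed

lemma cdf_two_point_law:
  assumes "x < y" "0 \<le> p" "0 \<le> q"
  shows "cdf (two_point_law p x q y) z = (if z < x then 0 else if z < y then p else p + q)"
proof -
  define g where "g b = (if b then y else x)" for b
  have "cdf (two_point_law p x q y) z
    = measure (point_measure {False, True} (\<lambda>b. ennreal (if b then q else p))) (g -` {..z})"
    unfolding cdf_def two_point_law_def g_def[symmetric]
    by (subst measure_distr) (auto simp: space_point_measure UNIV_bool[symmetric])
  also have "\<dots> = (\<Sum>b\<in>g -` {..z}. if b then q else p)"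
  proof -
    have fin: "finite (g -` {..z})" by (rule finite_subset[of _ UNIV]) auto
    have "emeasure (point_measure {False, True} (\<lambda>b. ennreal (if b then q else p))) (g -` {..z})
       = (\<Sum>b\<in>g -` {..z}. ennreal (if b then q else p))"
      using fin by (intro emeasure_point_measure_finite2) auto
    also have "\<dots> = ennreal (\<Sum>b\<in>g -` {..z}. if b then q else p)"
      by (rule sum_ennreal) (use assms in auto)
    finally show ?thesis
      unfolding measure_def using assms by (simp add: sum_nonneg)
  qed
  also have "g -` {..z} = (if z < x then {} else if z < y then {False} else {False, True})"
    using assms(1) by (auto simp: g_def split: if_splits)
  finally show ?thesis by simp
qed

text \<open>Outside the interval between the atoms the far-set estimates suffice. Between them the
  mass counted at x lies between that of the left window and that of the left window plus the far
  set; divided by the total, both tend to the share of the left phase.\<close>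

lemma density_law_weak_conv_two:
  assumes two: "maximizers \<beta> h = {a, b}" and ab: "0 < a" "a < b" "b < 1"
    and reg: "two_regular \<beta> h a" "two_regular \<beta> h b"
  shows "weak_conv_m (density_law \<beta> h)
     (two_point_law (phase_weight \<beta> h a b) (2 * a - 1) (phase_weight \<beta> h b a) (2 * b - 1))"
  unfolding weak_conv_m_def weak_conv_def
proof (intro allI impI)
  have a1: "a < 1" and b0: "0 < b" using ab by linarith+
  define La where "La = exp_nu a * q_weight \<beta> h a"
  define Lb where "Lb = exp_nu b * q_weight \<beta> h b"
  have L: "La > 0" "Lb > 0"
    unfolding La_def Lb_def gauss_moment_one[symmetric]
    using gauss_moment_one_pos[OF ab(1) a1 two_regular_derivs(2)[OF reg(1) ab(1) a1]]
      gauss_moment_one_pos[OF b0 ab(3) two_regular_derivs(2)[OF reg(2) b0 ab(3)]] by auto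
  define p where "p = phase_weight \<beta> h a b"
  define q where "q = phase_weight \<beta> h b a"
  have p: "p = La / (La + Lb)" and q: "q = Lb / (La + Lb)"
    by (simp_all add: p_def q_def phase_weight_def La_def Lb_def mult.commute add.commute)
  have pq: "p > 0" "q > 0" "p + q = 1"
    using L by (auto simp: p q add_divide_distrib[symmetric])
  define P where "P = two_point_law p (2 * a - 1) q (2 * b - 1)"
  have F: "cdf P z = (if z < 2 * a - 1 then 0 else if z < 2 * b - 1 then p else 1)" for z
    unfolding P_def using pq ab by (subst cdf_two_point_law) auto
  fix x assume "isCont (cdf (two_point_law (phase_weight \<beta> h a b) (2 * a - 1) (phase_weight \<beta> h b a) (2 * b - 1))) x"
  then have cont: "isCont (cdf P) x" by (simp add: P_def p_def q_def)
  have "x \<noteq> 2 * a - 1"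
  proof
    assume x: "x = 2 * a - 1"
    have "cdf P x = 0"
      using cont by (rule isCont_left_const[where x = x and y = "x - 1"]) (auto simp: F x)
    then show False using pq ab by (simp add: F x)
  qed
  moreover have "x \<noteq> 2 * b - 1"
  proof
    assume x: "x = 2 * b - 1"
    have "cdf P x = p"
      using cont by (rule isCont_left_const[where x = x and y = "2 * a - 1"]) (use ab in \<open>auto simp: F x\<close>)
    then show False using pq ab by (simp add: F x)
  qed
  ultimately consider "x < 2 * a - 1" | "2 * a - 1 < x" "x < 2 * b - 1" | "2 * b - 1 < x" by linarith
  then have "(\<lambda>n. cdf (density_law \<beta> h n) x) \<longlonglongrightarrow> cdf P x"
  proof cases
    case 1
    have "(\<lambda>n. cdf (density_law \<beta> h n) x) \<longlonglongrightarrow> 0"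
    proof (rule cdf_density_law_below[OF reg(1) ab(1) a1])
      show "0 < (2 * a - 1 - x) / 4" using 1 by simp
      show "x + 2 * ((2 * a - 1 - x) / 4) < 2 * c - 1" if "c \<in> maximizers \<beta> h" for c
        using that 1 ab two by (auto simp: field_simps)
    qed
    then show ?thesis using 1 by (simp add: F)
  next
    case 3
    have "(\<lambda>n. cdf (density_law \<beta> h n) x) \<longlonglongrightarrow> 1"
    proof (rule cdf_density_law_above[OF reg(1) ab(1) a1])
      show "0 < (x - (2 * b - 1)) / 4" using 3 by simp
      show "2 * c - 1 < x - 2 * ((x - (2 * b - 1)) / 4)" if "c \<in> maximizers \<beta> h" for c
        using that 3 ab two by (auto simp: field_simps)
    qed
    then show ?thesis using 3 ab by (simp add: F)
  next
    case 2
    obtain ra where ra: "0 < ra" "\<And>r. 0 < r \<Longrightarrow> r \<le> ra \<Longrightarrow> laplace_limit \<beta> h a (window a r)"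
      using laplace_limit_window[OF reg(1) ab(1) a1] by metis
    obtain rb where rb: "0 < rb" "\<And>r. 0 < r \<Longrightarrow> r \<le> rb \<Longrightarrow> laplace_limit \<beta> h b (window b r)"
      using laplace_limit_window[OF reg(2) b0 ab(3)] by metis
    \<comment> \<open>Small enough for both Laplace limits and for x to separate the two windows
      strictly on the magnetization scale.\<close>
    define r where "r = min (min ra rb) (min ((x - (2 * a - 1)) / 4) ((2 * b - 1 - x) / 4))"
    have r0: "0 < r" "r \<le> ra" "r \<le> rb" "r \<le> (x - (2 * a - 1)) / 4" "r \<le> (2 * b - 1 - x) / 4"
      unfolding r_def using 2 ra(1) rb(1)
      by (simp, intro min.coboundedI1 min.cobounded1, intro min.coboundedI1 min.cobounded2,
          intro min.coboundedI2 min.cobounded1, intro min.coboundedI2 min.cobounded2)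
    have "2 * (a + r) - 1 < x" using r0(1,4) by (simp add: field_simps)
    moreover have "x < 2 * (b - r) - 1" using r0(1,5) by (simp add: field_simps)
    ultimately have r: "0 < r" "r \<le> ra" "r \<le> rb" "2 * (a + r) - 1 < x" "x < 2 * (b - r) - 1"
      using r0 by blast+
    have am: "a \<in> maximizers \<beta> h" "b \<in> maximizers \<beta> h" using two by auto
    \<comment> \<open>The weights normalized at b are those normalized at a, so the masses of both
      phases are limits in the same normalization and can be added.\<close>
    note cong = scaled_weight_cong_maximizers[OF am(2,1)]
    define T where "T n K = total_weight \<beta> h a n K" for n K
    define R where "R n K = T n K / sqrt (real n)" for n K
    have Ra: "(\<lambda>n. R n (window a r n)) \<longlonglongrightarrow> La"
      unfolding R_def T_def La_def using r by (intro laplace_limit_total ra(2))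
    have Rb: "(\<lambda>n. R n (window b r n)) \<longlonglongrightarrow> Lb"
      using laplace_limit_total[OF rb(2)[OF r(1,3)]] unfolding R_def T_def Lb_def cong .
    have Rf: "(\<lambda>n. R n (far_set \<beta> h r n)) \<longlonglongrightarrow> 0"
      unfolding R_def T_def by (rule far_set_tendsto[OF am(1) r(1)])
    have split: "T n {..n} = T n (window a r n) + T n (window b r n) + T n (far_set \<beta> h r n)" for n
    proof -
      have u: "{..n} = (window a r n \<union> window b r n) \<union> far_set \<beta> h r n"
        using two by (auto simp: window_def far_set_def)
      have "window a r n \<inter> window b r n = {}"
        using r by (auto simp: window_def abs_le_iff)
      moreover have "(window a r n \<union> window b r n) \<inter> far_set \<beta> h r n = {}"
        using two by (auto simp: window_def far_set_def)
      ultimately show ?thesis unfolding T_def u by (simp add: sum.union_disjoint)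
    qed
    have "R n {..n} = R n (window a r n) + R n (window b r n) + R n (far_set \<beta> h r n)" for n
      unfolding R_def by (simp add: split add_divide_distrib)
    then have Rt: "(\<lambda>n. R n {..n}) \<longlonglongrightarrow> La + Lb"
      using tendsto_add[OF tendsto_add[OF Ra Rb] Rf] by simp
    have low: "(\<lambda>n. R n (window a r n) / R n {..n}) \<longlonglongrightarrow> p"
      unfolding p using L by (intro tendsto_divide Ra Rt) auto
    have up: "(\<lambda>n. (R n (window a r n) + R n (far_set \<beta> h r n)) / R n {..n}) \<longlonglongrightarrow> p"
      using tendsto_divide[OF tendsto_add[OF Ra Rf] Rt] L by (simp add: p)
    have sandwich: "\<forall>\<^sub>F n in sequentially. R n (window a r n) / R n {..n} \<le> cdf (density_law \<beta> h n) x
       \<and> cdf (density_law \<beta> h n) x \<le> (R n (window a r n) + R n (far_set \<beta> h r n)) / R n {..n}"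
      using eventually_ge_at_top[of 1]
    proof eventually_elim
      case (elim n)
      define K where "K = {k. k \<le> n \<and> 2 * (real k / real n) - 1 \<le> x}"
      have n: "sqrt (real n) > 0" using elim by simp
      have "T n {..n} > 0" unfolding T_def by (rule total_weight_pos[OF elim])
      then have Tn: "R n {..n} > 0" using n by (simp add: R_def)
      have cdf: "cdf (density_law \<beta> h n) x = R n K / R n {..n}"
        unfolding cdf_density_law[OF elim, of \<beta> h x a] K_def R_def T_def using n by simp
      have "window a r n \<subseteq> K"
        using r by (auto simp: window_def K_def abs_le_iff)
      moreover have "K \<subseteq> window a r n \<union> far_set \<beta> h r n"
      proof
        fix k assume k: "k \<in> K"
        then have "r < \<bar>real k / real n - b\<bar>"
          using r by (auto simp: K_def abs_if)
        then show "k \<in> window a r n \<union> far_set \<beta> h r n"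
          using k two by (auto simp: K_def window_def far_set_def)
      qed
      moreover have "finite K" by (rule finite_subset[of _ "{..n}"]) (auto simp: K_def)
      moreover have "T n (window a r n \<union> far_set \<beta> h r n) = T n (window a r n) + T n (far_set \<beta> h r n)"
        unfolding T_def by (rule sum.union_disjoint) (use two in \<open>auto simp: window_def far_set_def\<close>)
      ultimately have "T n (window a r n) \<le> T n K" "T n K \<le> T n (window a r n) + T n (far_set \<beta> h r n)"
        using total_weight_mono[of K "window a r n" \<beta> h a n]
          total_weight_mono[of "window a r n \<union> far_set \<beta> h r n" K \<beta> h a n]
        unfolding T_def by simp_all
      then have "R n (window a r n) \<le> R n K" "R n K \<le> R n (window a r n) + R n (far_set \<beta> h r n)"
        unfolding R_def add_divide_distrib[symmetric] using n by (auto intro: divide_right_mono)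
      then show ?case unfolding cdf using Tn by (auto intro: divide_right_mono)
    qed
    have "(\<lambda>n. cdf (density_law \<beta> h n) x) \<longlonglongrightarrow> p"
      by (rule tendsto_sandwich[OF _ _ low up]) (use sandwich in \<open>auto elim: eventually_mono\<close>)
    then show ?thesis using 2 by (simp add: F)
  qed
  then show "(\<lambda>n. cdf (density_law \<beta> h n) x)
    \<longlonglongrightarrow> cdf (two_point_law (phase_weight \<beta> h a b) (2 * a - 1) (phase_weight \<beta> h b a) (2 * b - 1)) x"
    by (simp add: P_def p_def q_def)
qed

theorem theorem5p3:
  fixes \<beta> h :: real and g :: "real \<Rightarrow> real"
  assumes "transition_function g" and "\<beta> > 0"
  shows
    "((\<beta>, h) \<notin> gamma_curve g \<longrightarrow>
       (\<forall>a. maximizers \<beta> h = {a} \<longrightarrow>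
          weak_conv_m (density_law \<beta> h) (return borel (2 * a - 1)) \<and>
          (\<exists>\<delta>0>0. \<forall>\<delta>. 0 < \<delta> \<and> \<delta> < \<delta>0 \<longrightarrow> (\<exists>c>0. \<forall>\<^sub>F n in sequentially.
             measure (gibbs \<beta> h n)
               {\<omega> \<in> space (gibbs \<beta> h n). \<bar>magnetization n \<omega> / real n - (2 * a - 1)\<bar> > \<delta>}
             \<le> exp (- c * real n))) \<and>
          (\<exists>C. \<forall>\<^sub>F n in sequentially.
             wasserstein (fluctuation_law \<beta> h n (2 * a - 1))
               (centered_normal (4 / \<bar>A_second \<beta> h a\<bar>))
             \<le> ennreal (C / sqrt (real n)))))
     \<and>
     ((\<beta>, h) \<in> gamma_curve g \<longrightarrow>
       (\<forall>am ap. maximizers \<beta> h = {am, ap} \<and> am = 1/2 \<and> am < ap \<longrightarrow>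
          (\<exists>\<delta>0>0. \<forall>\<delta>. 0 < \<delta> \<and> \<delta> < \<delta>0 \<longrightarrow> (\<exists>c>0. \<forall>\<^sub>F n in sequentially.
             measure (gibbs \<beta> h n)
               {\<omega> \<in> space (gibbs \<beta> h n).
                  \<forall>a\<in>{am, ap}. \<bar>magnetization n \<omega> / real n - (2 * a - 1)\<bar> > \<delta>}
             \<le> exp (- c * real n))) \<and>
          weak_conv_m (density_law \<beta> h)
            (two_point_law (phase_weight \<beta> h am ap) (2 * am - 1)
                           (phase_weight \<beta> h ap am) (2 * ap - 1)) \<and>
          (\<forall>a\<in>{am, ap}. \<exists>\<delta>0>0. \<forall>\<delta>. 0 < \<delta> \<and> \<delta> < \<delta>0 \<longrightarrow> (\<exists>C. \<forall>\<^sub>F n in sequentially.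
             wasserstein (cond_fluctuation_law \<beta> h n (2 * a - 1) \<delta>)
               (centered_normal (4 / \<bar>A_second \<beta> h a\<bar>))
             \<le> ennreal (C / sqrt (real n))))))"
proof (rule conjI; intro impI allI)
  fix a assume "(\<beta>, h) \<notin> gamma_curve g" and uniq: "maximizers \<beta> h = {a}"
  then have "(\<beta>, h) \<in> ({0<..} \<times> UNIV) - gamma_curve g" using assms(2) by simp
  \<comment> \<open>The transition function supplies regularity and 0 < a < 1; the singleton set of
    maximizers identifies the point.\<close>
  then obtain a' where "0 < a'" "a' < 1" "maximizers \<beta> h = {a'}" "two_regular \<beta> h a'"
    using assms(1) unfolding transition_function_def by blast
  with uniq have reg: "two_regular \<beta> h a" "0 < a" "a < 1" by auto
  show "weak_conv_m (density_law \<beta> h) (return borel (2 * a - 1)) \<and>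
          (\<exists>\<delta>0>0. \<forall>\<delta>. 0 < \<delta> \<and> \<delta> < \<delta>0 \<longrightarrow> (\<exists>c>0. \<forall>\<^sub>F n in sequentially.
             measure (gibbs \<beta> h n)
               {\<omega> \<in> space (gibbs \<beta> h n). \<bar>magnetization n \<omega> / real n - (2 * a - 1)\<bar> > \<delta>}
             \<le> exp (- c * real n))) \<and>
          (\<exists>C. \<forall>\<^sub>F n in sequentially.
             wasserstein (fluctuation_law \<beta> h n (2 * a - 1))
               (centered_normal (4 / \<bar>A_second \<beta> h a\<bar>))
             \<le> ennreal (C / sqrt (real n)))" (is "_ \<and> ?conc \<and> _")
  proof (intro conjI)
    \<comment> \<open>Concentration holds for every positive \<delta>, so the threshold 1 is an
      arbitrary witness.\<close>
    show ?conc
      using concentration[OF reg] unfolding uniq by (intro exI[of _ 1]) simp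
  qed (fact density_law_weak_conv_unique[OF uniq reg] wasserstein_full[OF uniq reg])+
next
  fix am ap assume gam: "(\<beta>, h) \<in> gamma_curve g"
    and "maximizers \<beta> h = {am, ap} \<and> am = 1/2 \<and> am < ap"
  then have two: "maximizers \<beta> h = {am, ap}" and am: "am = 1/2" "am < ap" by auto
  from gam obtain b where b: "1/2 < b" "b < 1" "maximizers \<beta> h = {1/2, b}"
      "two_regular \<beta> h (1/2)" "two_regular \<beta> h b"
    using assms(1) unfolding transition_function_def by blast
  \<comment> \<open>Both descriptions of the maximizers contain 1/2, so their other elements, both
    larger than 1/2, coincide.\<close>
  have "b = ap" using two am b by (auto simp: doubleton_eq_iff)
  have reg: "two_regular \<beta> h am" "two_regular \<beta> h ap"
    using b(4,5) unfolding am(1) \<open>b = ap\<close> .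
  have lt: "0 < am" "am < ap" "ap < 1" and lt': "am < 1" "0 < ap"
    using b am unfolding \<open>b = ap\<close> by linarith+
  show "(\<exists>\<delta>0>0. \<forall>\<delta>. 0 < \<delta> \<and> \<delta> < \<delta>0 \<longrightarrow> (\<exists>c>0. \<forall>\<^sub>F n in sequentially.
             measure (gibbs \<beta> h n)
               {\<omega> \<in> space (gibbs \<beta> h n).
                  \<forall>a\<in>{am, ap}. \<bar>magnetization n \<omega> / real n - (2 * a - 1)\<bar> > \<delta>}
             \<le> exp (- c * real n))) \<and>
          weak_conv_m (density_law \<beta> h)
            (two_point_law (phase_weight \<beta> h am ap) (2 * am - 1)
                           (phase_weight \<beta> h ap am) (2 * ap - 1)) \<and>
          (\<forall>a\<in>{am, ap}. \<exists>\<delta>0>0. \<forall>\<delta>. 0 < \<delta> \<and> \<delta> < \<delta>0 \<longrightarrow> (\<exists>C. \<forall>\<^sub>F n in sequentially.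
             wasserstein (cond_fluctuation_law \<beta> h n (2 * a - 1) \<delta>)
               (centered_normal (4 / \<bar>A_second \<beta> h a\<bar>))
             \<le> ennreal (C / sqrt (real n))))" (is "?conc \<and> ?law \<and> (\<forall>a\<in>_. ?fluct a)")
  proof (intro conjI)
    show ?conc
      using concentration[OF reg(1) lt(1) lt'(1)] unfolding two by (intro exI[of _ 1]) simp
    show ?law
      by (rule density_law_weak_conv_two[OF two lt reg])
    show "\<forall>a\<in>{am, ap}. ?fluct a"
    proof
      fix a assume "a \<in> {am, ap}"
      then have "two_regular \<beta> h a" "0 < a" "a < 1" using reg lt lt' by auto
      then show "?fluct a"
        by (rule wasserstein_window)
    qed
  qed
qed

end
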